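(* Let $k\ge 1$ be an integer, and let $G_k$ be the graph with vertex set $\{u_0,\dots,u_k\}\cup\{v_0,\dots,v_k\}\cup\{w_1,\dots,w_k\}$ obtained from the complete bipartite graph with parts $\{u_0,\dots,u_k\}$ and $\{v_0,\dots,v_k\}$ by deleting, for each $i=1,\dots,k$, the edge $\{u_i,v_i\}$ and adding the edges $\{u_i,w_i\}$ and $\{v_i,w_i\}$ (the edge $\{u_0,v_0\}$ is kept). Then: (i) $\nu\text{-rank}(G_k)\ge k-1$, i.e. (for $k\ge2$) $\nu^{(k-2)}(G_k)>\alpha(G_k)$. (ii) $\tilde\nu\text{-rank}(G_k)=1$.
   Context: $\mathbb N=\{0,1,2,\dots\}$; $\alpha(G)$ is the maximum size of a stable (independent) set of $G$. $\mathcal S^n$ is the space of real symmetric $n\times n$ matrices. For $\beta\in\mathbb N^n$ put $|\beta|=\sum_i\beta_i$ and $x^\beta=x_1^{\beta_1}\cdots x_n^{\beta_n}$. For $n,r\in\mathbb N$: $\mathcal N_{n,r}$ is the set of homogeneous polynomials of degree $r$ in $x_1,\dots,x_n$ with nonnegative coefficients (including $0$); $\mathcal H_{n,r}$ is the cone of homogeneous polynomials of degree $r+2$ (including $0$) of the form $\sum_{\beta\in\mathbb N^n,\ |\beta|\in\{r,r+2\}}x^\beta\sigma_\beta$, where each $\sigma_\beta$ is a sum of squares of real polynomials of degree at most $r+2-|\beta|$. $\|p\|_1$ is the sum of the absolute values of the coefficients of $p$. Define $$\mathcal Q_n^{(r)}=\Big\{M\in\mathcal S^n:\Big(\sum_{i=1}^nx_i\Big)^r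 x^TMx\in\mathcal H_{n,r}\Big\},$$ $$\widetilde{\mathcal Q}_n^{(r)}=\{M\in\mathcal S^n:\ p\cdot x^TMx\in\mathcal H_{n,r}\text{ for some }p\in\mathcal N_{n,r}\text{ with }\|p\|_1=1\}.$$ For a graph $G$ on $n$ vertices with adjacency matrix $A_G$, with $I$ the identity and $J$ the all-ones $n\times n$ matrix, $\nu^{(r)}(G)=\min\{t\in\mathbb R: t(A_G+I)-J\in\mathcal Q_n^{(r)}\}$ and $\tilde\nu^{(r)}(G)=\min\{t\in\mathbb R: t(A_G+I)-J\in\widetilde{\mathcal Q}_n^{(r)}\}$. Further $\nu\text{-rank}(G)=\min\{r\in\mathbb N:\nu^{(r)}(G)=\alpha(G)\}$ and $\tilde\nu\text{-rank}(G)=\min\{r\in\mathbb N:\tilde\nu^{(r)}(G)=\alpha(G)\}$ (each equal to $+\infty$ if no such $r$ exists). *)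

theory Defs
  imports Complex_Main "HOL-Library.Poly_Mapping" "HOL-Library.Extended_Nat"
begin

text \<open>
  Vectors, matrices and polynomials are indexed by a finite set \<open>X\<close> of arbitrary type, rather than
  by \<open>{1..n}\<close>, so that the rows and columns of the matrices of a graph can be indexed by its
  vertices; \<open>n\<close> is \<open>card X\<close>. A polynomial is a finitely supported map from exponent vectors to
  coefficients, and an exponent vector a finitely supported map from variables to exponents.
\<close>

type_synonym 'a expvec = "'a \<Rightarrow>\<^sub>0 nat"
type_synonym 'a rpoly = "'a expvec \<Rightarrow>\<^sub>0 real"

definition exps :: "'a set \<Rightarrow> 'a expvec set" where
  "exps X = {\<beta>. Poly_Mapping.keys \<beta> \<subseteq> X}"

definition deg :: "'a expvec \<Rightarrow> nat" where
  "deg \<beta> = (\<Sum>i\<in>Poly_Mapping.keys \<beta>. Poly_Mapping.lookup \<beta> i)"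

definition polys :: "'a set \<Rightarrow> 'a rpoly set" where
  "polys X = {p. Poly_Mapping.keys p \<subseteq> exps X}"

definition degree_le :: "nat \<Rightarrow> 'a rpoly \<Rightarrow> bool" where
  "degree_le d p \<longleftrightarrow> (\<forall>\<beta>\<in>Poly_Mapping.keys p. deg \<beta> \<le> d)"

text \<open>The zero polynomial is homogeneous of every degree.\<close>

definition homogeneous :: "nat \<Rightarrow> 'a rpoly \<Rightarrow> bool" where
  "homogeneous d p \<longleftrightarrow> (\<forall>\<beta>\<in>Poly_Mapping.keys p. deg \<beta> = d)"

definition var :: "'a \<Rightarrow> 'a rpoly" where
  "var i = Poly_Mapping.single (Poly_Mapping.single i 1) 1"

definition const :: "real \<Rightarrow> 'a rpoly" where
  "const c = Poly_Mapping.single 0 c"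

definition mono_power :: "'a expvec \<Rightarrow> 'a rpoly" where
  "mono_power \<beta> = (\<Prod>i\<in>Poly_Mapping.keys \<beta>. var i ^ Poly_Mapping.lookup \<beta> i)"

definition norm1 :: "'a rpoly \<Rightarrow> real" where
  "norm1 p = (\<Sum>\<beta>\<in>Poly_Mapping.keys p. \<bar>Poly_Mapping.lookup p \<beta>\<bar>)"

definition sos :: "'a set \<Rightarrow> 'a rpoly set" where
  "sos X = {\<sigma>. \<exists>(m::nat) q. (\<forall>j<m. q j \<in> polys X) \<and> \<sigma> = (\<Sum>j<m. (q j)\<^sup>2)}"

definition Ncone :: "'a set \<Rightarrow> nat \<Rightarrow> 'a rpoly set" where
  "Ncone X r = {p \<in> polys X. homogeneous r p \<and> (\<forall>\<beta>. Poly_Mapping.lookup p \<beta> \<ge> 0)}"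

text \<open>
  The degree bound is on the sum of squares \<open>\<sigma> \<beta>\<close> itself: it has degree at most 2 for
  \<open>deg \<beta> = r\<close> and is a nonnegative constant for \<open>deg \<beta> = r + 2\<close>. Bounding the degree of the
  squared polynomials by \<open>r + 2 - deg \<beta>\<close> instead gives the same cone: the component of degree
  \<open>r + 4\<close> of the sum has to vanish, and it is a sum of terms that are nonnegative on the
  nonnegative orthant, so no squared polynomial can have degree 2.
\<close>

definition Hcone :: "'a set \<Rightarrow> nat \<Rightarrow> 'a rpoly set" where
  "Hcone X r = {f \<in> polys X. homogeneous (r + 2) f \<and>
     (\<exists>\<sigma>. (\<forall>\<beta>\<in>exps X. deg \<beta> \<in> {r, r + 2} \<longrightarrow>
              \<sigma> \<beta> \<in> sos X \<and> degree_le (r + 2 - deg \<beta>) (\<sigma> \<beta>)) \<and>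
          f = (\<Sum>\<beta> | \<beta> \<in> exps X \<and> deg \<beta> \<in> {r, r + 2}. mono_power \<beta> * \<sigma> \<beta>))}"

text \<open>The index set of the sum in \<open>Hcone\<close> is finite.\<close>

lemma finite_exps_deg:
  assumes "finite X" "finite D"
  shows "finite {\<beta> \<in> exps X. deg \<beta> \<in> D}"
proof -
  let ?S = "{\<beta> \<in> exps X. deg \<beta> \<in> D}"
  define N where "N = Max (insert 0 D)"
  have "Poly_Mapping.lookup \<beta> i \<le> N" if "\<beta> \<in> ?S" for \<beta> i
  proof -
    have "Poly_Mapping.lookup \<beta> i \<le> deg \<beta>"
    proof (cases "i \<in> Poly_Mapping.keys \<beta>")
      case True
      then show ?thesis unfolding deg_def by (intro member_le_sum) auto
    qed (simp add: in_keys_iff)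
    also have "deg \<beta> \<le> N" unfolding N_def using that assms by auto
    finally show ?thesis .
  qed
  then have "Poly_Mapping.lookup ` ?S \<subseteq>
      {g. \<forall>i. (i \<in> X \<longrightarrow> g i \<in> {..N}) \<and> (i \<notin> X \<longrightarrow> g i = 0)}"
    by (fastforce simp: exps_def in_keys_iff)
  moreover have "finite {g. \<forall>i. (i \<in> X \<longrightarrow> g i \<in> {..N}) \<and> (i \<notin> X \<longrightarrow> g i = (0::nat))}"
    using assms by (intro finite_set_of_finite_funs) auto
  ultimately have "finite (Poly_Mapping.lookup ` ?S)"
    by (rule finite_subset)
  moreover have "inj_on Poly_Mapping.lookup ?S"
    by (rule inj_onI) (rule poly_mapping_eqI, metis)
  ultimately show ?thesis by (rule finite_imageD)
qed

definition quad_form :: "'a set \<Rightarrow> ('a \<Rightarrow> 'a \<Rightarrow> real) \<Rightarrow> 'a rpoly" where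
  "quad_form X M = (\<Sum>i\<in>X. \<Sum>j\<in>X. const (M i j) * var i * var j)"

definition symmetric_on :: "'a set \<Rightarrow> ('a \<Rightarrow> 'a \<Rightarrow> real) \<Rightarrow> bool" where
  "symmetric_on X M \<longleftrightarrow> (\<forall>i\<in>X. \<forall>j\<in>X. M i j = M j i)"

definition Qcone :: "'a set \<Rightarrow> nat \<Rightarrow> ('a \<Rightarrow> 'a \<Rightarrow> real) set" where
  "Qcone X r = {M. symmetric_on X M \<and> (\<Sum>i\<in>X. var i) ^ r * quad_form X M \<in> Hcone X r}"

definition Qcone_tilde :: "'a set \<Rightarrow> nat \<Rightarrow> ('a \<Rightarrow> 'a \<Rightarrow> real) set" where
  "Qcone_tilde X r = {M. symmetric_on X M \<and>
     (\<exists>p\<in>Ncone X r. norm1 p = 1 \<and> p * quad_form X M \<in> Hcone X r)}"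

record 'a graph =
  verts :: "'a set"
  edges :: "'a set set"

definition simple_graph :: "'a graph \<Rightarrow> bool" where
  "simple_graph G \<longleftrightarrow> finite (verts G) \<and> (\<forall>e\<in>edges G. e \<subseteq> verts G \<and> card e = 2)"

definition stable :: "'a graph \<Rightarrow> 'a set \<Rightarrow> bool" where
  "stable G S \<longleftrightarrow> S \<subseteq> verts G \<and> (\<forall>x\<in>S. \<forall>y\<in>S. {x, y} \<notin> edges G)"

definition stability_number :: "'a graph \<Rightarrow> nat" where
  "stability_number G = Max (card ` {S. stable G S})"

definition adjacency :: "'a graph \<Rightarrow> 'a \<Rightarrow> 'a \<Rightarrow> real" where
  "adjacency G i j = (if {i, j} \<in> edges G then 1 else 0)"

text \<open>The matrix \<open>t(A\<^sub>G + I) - J\<close>.\<close>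

definition graph_matrix :: "'a graph \<Rightarrow> real \<Rightarrow> 'a \<Rightarrow> 'a \<Rightarrow> real" where
  "graph_matrix G t i j = t * (adjacency G i j + (if i = j then 1 else 0)) - 1"

text \<open>On \<^typ>\<open>real\<close>, \<open>LEAST t. P t\<close> is the minimum of the set of all \<open>t\<close> with \<open>P t\<close>, when there is one.\<close>

definition nu :: "nat \<Rightarrow> 'a graph \<Rightarrow> real" where
  "nu r G = (LEAST t. graph_matrix G t \<in> Qcone (verts G) r)"

definition nu_tilde :: "nat \<Rightarrow> 'a graph \<Rightarrow> real" where
  "nu_tilde r G = (LEAST t. graph_matrix G t \<in> Qcone_tilde (verts G) r)"

text \<open>
  Every nonempty set of extended naturals contains its infimum, and the infimum of the empty set
  is \<open>\<infinity>\<close>.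
\<close>

definition nu_rank :: "'a graph \<Rightarrow> enat" where
  "nu_rank G = Inf {enat r | r. nu r G = real (stability_number G)}"

definition nu_tilde_rank :: "'a graph \<Rightarrow> enat" where
  "nu_tilde_rank G = Inf {enat r | r. nu_tilde r G = real (stability_number G)}"

datatype vertex = Vu nat | Vv nat | Vw nat

definition Gk :: "nat \<Rightarrow> vertex graph" where
  "Gk k = \<lparr>
     verts = Vu ` {0..k} \<union> Vv ` {0..k} \<union> Vw ` {1..k},
     edges = ({{Vu i, Vv j} | i j. i \<in> {0..k} \<and> j \<in> {0..k}} - {{Vu i, Vv i} | i. i \<in> {1..k}})
       \<union> {{Vu i, Vw i} | i. i \<in> {1..k}} \<union> {{Vv i, Vw i} | i. i \<in> {1..k}} \<rparr>"

lemma simple_graph_Gk: "simple_graph (Gk k)"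
  unfolding simple_graph_def Gk_def by (simp, safe; simp)

end

theory Submission
  imports Defs "HOL-Analysis.Function_Topology" "HOL-Analysis.Convex"
begin

text \<open>
  Membership in \<open>Hcone X r\<close> means being a sum of terms \<open>x\<^sup>\<beta> Q\<^sub>\<beta>\<close>, with \<open>deg \<beta> = r\<close> and \<open>Q\<^sub>\<beta>\<close> a positive
  semidefinite quadratic form, and of monomials of degree \<open>r + 2\<close> with nonnegative coefficients
  (\<open>Hcone_iff_cert\<close>). All terms are nonnegative on the nonnegative orthant. Write \<open>\<alpha>\<close> for the stability
  number and \<open>M\<^sub>t = t(A + I) - J\<close>.

  The lower bound on the \<open>\<nu>\<close>-rank (\<open>critical_pairs_obstruction\<close>). The form of \<open>M\<^sub>\<alpha>\<close> vanishes at the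
  indicator vector of every maximum stable set \<open>S\<close>. Hence \<open>Q\<^sub>\<beta>\<close> vanishes there as soon as \<open>S\<close> contains
  the support of \<open>\<beta>\<close>, and then its matrix annihilates that vector. If two vertices \<open>a\<close>, \<open>b\<close> complete the
  same set, containing the support of \<open>\<beta>\<close>, to a maximum stable set, the columns of the matrix at \<open>a\<close>
  and at \<open>b\<close> are therefore equal. In \<open>G\<^sub>k\<close> the vertices \<open>u\<^sub>0, v\<^sub>0, u\<^sub>i, v\<^sub>i, w\<^sub>i\<close> span a 5-cycle, and each of
  its nonadjacent pairs together with all \<open>w\<^sub>j\<close>, \<open>j \<noteq> i\<close>, is a maximum stable set. Going round the cycle,
  the columns at \<open>w\<^sub>i\<close> and \<open>u\<^sub>0\<close> agree whenever \<open>\<beta>\<close> consists of \<open>w\<^sub>j\<close> with \<open>j \<noteq> i\<close>. So the entry at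
  \<open>w\<^sub>i, w\<^sub>j\<close> equals a diagonal entry, which is nonnegative, if \<open>\<beta>\<close> avoids both. For \<open>r \<le> k - 2\<close> there are
  \<open>r + 2\<close> distinct vertices \<open>w\<close>; the coefficient of their product is nonnegative in every certificate
  of order \<open>r\<close>, but it is negative in \<open>(\<Sum>x)\<^sup>r x\<^sup>T M\<^sub>\<alpha> x\<close>, since the vertices are pairwise nonadjacent. The
  same argument with \<open>u\<^sub>0, u\<^sub>1\<close> excludes \<open>r = 0\<close> for all \<open>k \<ge> 1\<close>.

  This shows that \<open>t = \<alpha>\<close> is not admissible. Evaluation at a maximum stable set shows that no smaller
  \<open>t\<close> is (\<open>stable_lower_bound\<close>), and a compactness argument shows that the least admissible \<open>t\<close> exists
  (\<open>nu_attained\<close>). Together they give \<open>\<nu>\<^sup>(\<^sup>r\<^sup>) > \<alpha>\<close>.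

  The modified rank. For \<open>r = 0\<close> the only normalised multiplier is \<open>1\<close>, so the modified bound is the
  original one and exceeds \<open>\<alpha>\<close>. For \<open>r = 1\<close> the multiplier is the mean of the variables in
  \<open>T = {u\<^sub>0, \<dots>, u\<^sub>k, v\<^sub>0, \<dots>, v\<^sub>k}\<close> (\<open>clique_partitions_Qcone_tilde\<close>). For \<open>s \<in> T\<close> the vertices outside the
  closed neighbourhood of \<open>s\<close> fall into \<open>k = \<alpha> - 1\<close> cliques. With these cliques and the neighbourhood
  as classes, the matrix with entries \<open>\<alpha> - 1\<close> inside the classes and \<open>-1\<close> elsewhere is positive
  semidefinite by Cauchy-Schwarz. It differs from \<open>M\<^sub>\<alpha>\<close> by a matrix that is negative only at
  nonadjacent neighbours \<open>a, b\<close> of \<open>s\<close>. One of \<open>a, b\<close>, say \<open>a\<close>, is again in \<open>T\<close>, and the matrix that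
  belongs to \<open>a\<close> has a positive entry at \<open>s, b\<close>, which makes up for the loss at the monomial \<open>x\<^sub>s x\<^sub>a x\<^sub>b\<close>.
\<close>

abbreviation lookup :: "('a \<Rightarrow>\<^sub>0 'b::zero) \<Rightarrow> 'a \<Rightarrow> 'b" where
  "lookup \<equiv> Poly_Mapping.lookup"
abbreviation keys :: "('a \<Rightarrow>\<^sub>0 'b::zero) \<Rightarrow> 'a set" where
  "keys \<equiv> Poly_Mapping.keys"
abbreviation single :: "'a \<Rightarrow> 'b \<Rightarrow> 'a \<Rightarrow>\<^sub>0 'b::zero" where
  "single \<equiv> Poly_Mapping.single"
abbreviation unit_exp :: "'a \<Rightarrow> 'a expvec" where
  "unit_exp i \<equiv> single i 1"

text \<open>Keeps \<open>single i 1\<close>, the exponent of a variable, in the form in which the lemmas are stated.\<close>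

declare One_nat_def [simp del]

section \<open>Monomials, coefficients and degrees\<close>

lemma poly_mapping_expand: "p = (\<Sum>\<beta>\<in>keys p. single \<beta> (lookup p \<beta>))"
proof (rule poly_mapping_eqI)
  fix k
  show "lookup p k = lookup (\<Sum>\<beta>\<in>keys p. single \<beta> (lookup p \<beta>)) k"
    by (cases "k \<in> keys p") (auto simp: lookup_sum lookup_single when_def in_keys_iff)
qed

lemma mult_expand:
  "p * q = (\<Sum>\<beta>\<in>keys p. \<Sum>\<delta>\<in>keys q. single (\<beta> + \<delta>) (lookup p \<beta> * lookup q \<delta> :: real))"
proof -
  have "p * q = (\<Sum>\<beta>\<in>keys p. single \<beta> (lookup p \<beta>)) * (\<Sum>\<delta>\<in>keys q. single \<delta> (lookup q \<delta>))"
    using arg_cong2 [where f = "(*)", OF poly_mapping_expand [of p] poly_mapping_expand [of q]] .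
  then show ?thesis by (simp add: sum_product mult_single)
qed

lemma keys_add_nat: "keys (\<beta> + \<delta> :: 'a expvec) = keys \<beta> \<union> keys \<delta>"
  by (auto simp: in_keys_iff lookup_add)

lemma single_power: "single \<beta> (1::real) ^ n = single (\<Sum>j<n. \<beta>) 1"
proof (induction n)
  case (Suc n)
  have "single \<beta> (1::real) ^ Suc n = single (\<beta> + (\<Sum>j<n. \<beta>)) 1"
    by (simp add: Suc mult_single)
  then show ?case by (simp add: add.commute)
qed simp

lemma sum_const_expvec: "(\<Sum>j<n. single i (1::nat)) = single i n"
  by (rule poly_mapping_eqI) (simp add: lookup_sum lookup_single when_def)

lemma prod_single: "finite A \<Longrightarrow> (\<Prod>i\<in>A. single (f i) (1::real)) = single (\<Sum>i\<in>A. f i) 1"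
  by (induction A rule: finite_induct) (auto simp: mult_single)

lemma mono_power_eq_single: "mono_power \<beta> = single \<beta> 1"
  unfolding mono_power_def var_def single_power sum_const_expvec
  by (simp add: prod_single poly_mapping_expand [of \<beta>, symmetric])

lemma var_eq: "var i = single (unit_exp i) 1"
  by (simp add: var_def)

lemma lookup_const_mult: "lookup (const c * p) \<gamma> = c * lookup p \<gamma>"
proof -
  have "const c * p = (\<Sum>\<beta>\<in>keys p. single \<beta> (c * lookup p \<beta>))"
    unfolding const_def
    by (subst (1) poly_mapping_expand [of p]) (simp add: sum_distrib_left mult_single)
  then show ?thesis
    by (cases "\<gamma> \<in> keys p") (auto simp: lookup_sum lookup_single when_def in_keys_iff)
qed

lemma const_add: "const (a + b) = const a + const b"
  by (simp add: const_def single_add)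

lemma const_mult: "const (a * b) = const a * const b"
  by (simp add: const_def mult_single)

lemma const_0 [simp]: "const 0 = 0" and const_1 [simp]: "const 1 = 1"
  by (simp_all add: const_def)

lemma deg_superset:
  assumes "finite A" "keys \<beta> \<subseteq> A"
  shows "deg \<beta> = (\<Sum>i\<in>A. lookup \<beta> i)"
  unfolding deg_def using assms by (intro sum.mono_neutral_left) (auto simp: in_keys_iff)

lemma deg_add: "deg (\<beta> + \<delta>) = deg \<beta> + deg \<delta>"
  using deg_superset [of "keys \<beta> \<union> keys \<delta>" \<beta>] deg_superset [of "keys \<beta> \<union> keys \<delta>" \<delta>]
    deg_superset [of "keys \<beta> \<union> keys \<delta>" "\<beta> + \<delta>"]
  by (simp add: keys_add_nat lookup_add sum.distrib)

lemma deg_0 [simp]: "deg 0 = 0"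
  by (simp add: deg_def)

lemma deg_single [simp]: "deg (single i n) = n"
  by (cases "n = 0") (auto simp: deg_def)

lemma deg_eq_0_iff: "deg \<beta> = 0 \<longleftrightarrow> \<beta> = 0"
proof
  assume "deg \<beta> = 0"
  then show "\<beta> = 0" by (auto simp: deg_def in_keys_iff intro: poly_mapping_eqI)
qed simp

lemma exps_add [intro]: "\<beta> \<in> exps X \<Longrightarrow> \<delta> \<in> exps X \<Longrightarrow> \<beta> + \<delta> \<in> exps X"
  by (auto simp: exps_def keys_add_nat)

lemma exps_addD: "\<beta> + \<delta> \<in> exps X \<Longrightarrow> \<beta> \<in> exps X \<and> \<delta> \<in> exps X"
  by (auto simp: exps_def keys_add_nat)

lemma exps_0 [simp]: "0 \<in> exps X"
  by (simp add: exps_def)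

lemma exps_unit [intro]: "i \<in> X \<Longrightarrow> unit_exp i \<in> exps X"
  by (simp add: exps_def)

lemma exps_split:
  assumes "deg \<beta> = Suc d" "\<beta> \<in> exps X"
  obtains i \<delta> where "i \<in> X" "\<delta> \<in> exps X" "deg \<delta> = d" "\<beta> = unit_exp i + \<delta>"
proof -
  obtain i where i: "i \<in> keys \<beta>" using assms(1) by (fastforce simp: deg_def)
  define \<delta> where "\<delta> = \<beta> - unit_exp i"
  have "\<beta> = unit_exp i + \<delta>"
    using i by (intro poly_mapping_eqI) (auto simp: \<delta>_def lookup_add lookup_minus lookup_single when_def in_keys_iff)
  moreover from this have "deg \<delta> = d" using assms(1) by (simp add: deg_add)
  ultimately show thesis
    using that i assms(2) exps_addD by (metis exps_def mem_Collect_eq subsetD)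
qed

section \<open>Closure properties\<close>

lemma polys_iff: "p \<in> polys X \<longleftrightarrow> (\<forall>\<beta>. lookup p \<beta> \<noteq> 0 \<longrightarrow> \<beta> \<in> exps X)"
  by (auto simp: polys_def in_keys_iff)

lemma homogeneous_iff: "homogeneous d p \<longleftrightarrow> (\<forall>\<beta>. lookup p \<beta> \<noteq> 0 \<longrightarrow> deg \<beta> = d)"
  by (auto simp: homogeneous_def in_keys_iff)

lemma degree_le_iff: "degree_le d p \<longleftrightarrow> (\<forall>\<beta>. lookup p \<beta> \<noteq> 0 \<longrightarrow> deg \<beta> \<le> d)"
  by (auto simp: degree_le_def in_keys_iff)

lemma polys_add [intro]: "p \<in> polys X \<Longrightarrow> q \<in> polys X \<Longrightarrow> p + q \<in> polys X"
  using keys_add [of p q] by (auto simp: polys_def)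

lemma polys_mult [intro]: "p \<in> polys X \<Longrightarrow> q \<in> polys X \<Longrightarrow> p * q \<in> polys X"
  using keys_mult [of p q] by (fastforce simp: polys_def)

lemma polys_0 [simp]: "0 \<in> polys X" and polys_1 [simp]: "1 \<in> polys X"
  and polys_const [simp]: "const c \<in> polys X"
  by (auto simp: polys_def const_def)

lemma polys_single [intro]: "\<beta> \<in> exps X \<Longrightarrow> single \<beta> c \<in> polys X"
  by (auto simp: polys_def)

lemma polys_var [intro]: "i \<in> X \<Longrightarrow> var i \<in> polys X"
  by (auto simp: var_eq)

lemma polys_sum [intro]: "(\<And>i. i \<in> A \<Longrightarrow> f i \<in> polys X) \<Longrightarrow> (\<Sum>i\<in>A. f i) \<in> polys X"
  by (induction A rule: infinite_finite_induct) auto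

lemma polys_power [intro]: "p \<in> polys X \<Longrightarrow> p ^ n \<in> polys X"
  by (induction n) auto

lemma polys_mono: "X \<subseteq> Y \<Longrightarrow> polys X \<subseteq> polys Y"
  by (auto simp: polys_def exps_def)

lemma homogeneous_0 [simp]: "homogeneous d 0" and homogeneous_1 [simp]: "homogeneous 0 1"
  by (auto simp: homogeneous_def)

lemma homogeneous_const [simp]: "homogeneous 0 (const c)"
  by (auto simp: homogeneous_def const_def)

lemma homogeneous_add [intro]: "homogeneous d p \<Longrightarrow> homogeneous d q \<Longrightarrow> homogeneous d (p + q)"
  using keys_add [of p q] by (auto simp: homogeneous_def)

lemma homogeneous_diff [intro]: "homogeneous d p \<Longrightarrow> homogeneous d q \<Longrightarrow> homogeneous d (p - q)"
  using keys_diff [of p q] by (auto simp: homogeneous_def)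

lemma homogeneous_mult: "homogeneous d p \<Longrightarrow> homogeneous e q \<Longrightarrow> homogeneous (d + e) (p * q)"
  using keys_mult [of p q] by (fastforce simp: homogeneous_def deg_add)

lemma homogeneous_sum [intro]: "(\<And>i. i \<in> A \<Longrightarrow> homogeneous d (f i)) \<Longrightarrow> homogeneous d (\<Sum>i\<in>A. f i)"
  by (induction A rule: infinite_finite_induct) auto

lemma homogeneous_power: "homogeneous d p \<Longrightarrow> homogeneous (n * d) (p ^ n)"
  by (induction n) (auto simp: homogeneous_mult)

lemma homogeneous_single: "homogeneous (deg \<beta>) (single \<beta> c)"
  by (auto simp: homogeneous_def)

lemma homogeneous_var [simp]: "homogeneous 1 (var i)"
  by (auto simp: homogeneous_def var_eq)

lemma degree_le_homogeneous: "homogeneous d p \<Longrightarrow> degree_le d p"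
  by (auto simp: degree_le_def homogeneous_def)

section \<open>Evaluation\<close>

definition mval :: "('a \<Rightarrow> real) \<Rightarrow> 'a expvec \<Rightarrow> real" where
  "mval x \<beta> = (\<Prod>i\<in>keys \<beta>. x i ^ lookup \<beta> i)"

definition peval :: "('a \<Rightarrow> real) \<Rightarrow> 'a rpoly \<Rightarrow> real" where
  "peval x p = (\<Sum>\<beta>\<in>keys p. lookup p \<beta> * mval x \<beta>)"

lemma mval_superset:
  assumes "finite A" "keys \<beta> \<subseteq> A"
  shows "mval x \<beta> = (\<Prod>i\<in>A. x i ^ lookup \<beta> i)"
  unfolding mval_def using assms by (intro prod.mono_neutral_left) (auto simp: in_keys_iff)

lemma mval_add: "mval x (\<beta> + \<delta>) = mval x \<beta> * mval x \<delta>"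
  using mval_superset [of "keys \<beta> \<union> keys \<delta>" \<beta> x] mval_superset [of "keys \<beta> \<union> keys \<delta>" \<delta> x]
    mval_superset [of "keys \<beta> \<union> keys \<delta>" "\<beta> + \<delta>" x]
  by (simp add: keys_add_nat lookup_add prod.distrib power_add)

lemma mval_0 [simp]: "mval x 0 = 1"
  by (simp add: mval_def)

lemma mval_unit [simp]: "mval x (unit_exp i) = x i"
  by (simp add: mval_def)

lemma mval_scale: "mval (\<lambda>i. s * x i) \<beta> = s ^ deg \<beta> * mval x \<beta>"
  by (simp add: mval_def deg_def power_mult_distrib prod.distrib power_sum)

lemma mval_nonneg: "(\<And>i. i \<in> keys \<beta> \<Longrightarrow> 0 \<le> x i) \<Longrightarrow> 0 \<le> mval x \<beta>"
  unfolding mval_def by (intro prod_nonneg) auto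

lemma mval_ge_1: "(\<And>i. i \<in> keys \<beta> \<Longrightarrow> 1 \<le> x i) \<Longrightarrow> 1 \<le> mval x \<beta>"
  unfolding mval_def by (intro prod_ge_1) auto

lemma mval_pos: "(\<And>i. i \<in> keys \<beta> \<Longrightarrow> 0 < x i) \<Longrightarrow> 0 < mval x \<beta>"
  unfolding mval_def by (intro prod_pos) auto

lemma peval_superset:
  assumes "finite A" "keys p \<subseteq> A"
  shows "peval x p = (\<Sum>\<beta>\<in>A. lookup p \<beta> * mval x \<beta>)"
  unfolding peval_def using assms by (intro sum.mono_neutral_left) (auto simp: in_keys_iff)

lemma peval_add: "peval x (p + q) = peval x p + peval x q"
proof -
  have "keys (p + q) \<subseteq> keys p \<union> keys q" by (rule keys_add)
  then show ?thesis
    using peval_superset [of "keys p \<union> keys q" p x] peval_superset [of "keys p \<union> keys q" q x]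
      peval_superset [of "keys p \<union> keys q" "p + q" x]
    by (simp add: lookup_add algebra_simps sum.distrib)
qed

lemma peval_0 [simp]: "peval x 0 = 0"
  by (simp add: peval_def)

lemma peval_single [simp]: "peval x (single \<beta> c) = c * mval x \<beta>"
  by (simp add: peval_def)

lemma peval_1 [simp]: "peval x 1 = 1"
  by (simp add: peval_def)

lemma peval_sum: "peval x (\<Sum>i\<in>A. f i) = (\<Sum>i\<in>A. peval x (f i))"
  by (induction A rule: infinite_finite_induct) (auto simp: peval_add)

lemma peval_mult: "peval x (p * q) = peval x p * peval x q"
proof -
  have "peval x (p * q) = (\<Sum>\<beta>\<in>keys p. \<Sum>\<delta>\<in>keys q. (lookup p \<beta> * mval x \<beta>) * (lookup q \<delta> * mval x \<delta>))"
    by (simp add: mult_expand [of p q] peval_sum mval_add mult_ac)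
  also have "\<dots> = peval x p * peval x q"
    by (simp add: peval_def sum_product)
  finally show ?thesis .
qed

lemma peval_power: "peval x (p ^ n) = peval x p ^ n"
  by (induction n) (auto simp: peval_mult)

lemma peval_var [simp]: "peval x (var i) = x i"
  by (simp add: var_eq)

lemma peval_const [simp]: "peval x (const c) = c"
  by (simp add: const_def)

lemma peval_mono_power [simp]: "peval x (mono_power \<beta>) = mval x \<beta>"
  by (simp add: mono_power_eq_single)

lemma peval_sos_nonneg: "\<sigma> \<in> sos X \<Longrightarrow> 0 \<le> peval x \<sigma>"
  by (auto simp: sos_def peval_sum power2_eq_square peval_mult intro!: sum_nonneg)

section \<open>Polynomials with nonnegative coefficients\<close>

definition nonneg_coeffs :: "'a rpoly \<Rightarrow> bool" where
  "nonneg_coeffs p \<longleftrightarrow> (\<forall>\<beta>. 0 \<le> lookup p \<beta>)"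

lemma nonneg_coeffs_0 [simp]: "nonneg_coeffs 0" and nonneg_coeffs_1 [simp]: "nonneg_coeffs 1"
  by (auto simp: nonneg_coeffs_def lookup_one when_def)

lemma nonneg_coeffs_add [intro]: "nonneg_coeffs p \<Longrightarrow> nonneg_coeffs q \<Longrightarrow> nonneg_coeffs (p + q)"
  by (auto simp: nonneg_coeffs_def lookup_add)

lemma nonneg_coeffs_sum [intro]: "(\<And>i. i \<in> A \<Longrightarrow> nonneg_coeffs (f i)) \<Longrightarrow> nonneg_coeffs (\<Sum>i\<in>A. f i)"
  by (induction A rule: infinite_finite_induct) auto

lemma nonneg_coeffs_single [intro]: "0 \<le> c \<Longrightarrow> nonneg_coeffs (single \<beta> c)"
  by (auto simp: nonneg_coeffs_def lookup_single when_def)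

lemma nonneg_coeffs_var [simp]: "nonneg_coeffs (var i)"
  by (auto simp: var_eq)

lemma nonneg_coeffs_const [intro]: "0 \<le> c \<Longrightarrow> nonneg_coeffs (const c)"
  by (auto simp: const_def)

lemma nonneg_coeffs_mult [intro]:
  assumes "nonneg_coeffs p" "nonneg_coeffs q"
  shows "nonneg_coeffs (p * q)"
proof -
  have "nonneg_coeffs (\<Sum>\<beta>\<in>keys p. \<Sum>\<delta>\<in>keys q. single (\<beta> + \<delta>) (lookup p \<beta> * lookup q \<delta>))"
    using assms by (intro nonneg_coeffs_sum nonneg_coeffs_single) (auto simp: nonneg_coeffs_def)
  then show ?thesis by (simp add: mult_expand [of p q])
qed

lemma nonneg_coeffs_power [intro]: "nonneg_coeffs p \<Longrightarrow> nonneg_coeffs (p ^ n)"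
  by (induction n) auto

lemma lookup_mult_pos:
  assumes "nonneg_coeffs p" "nonneg_coeffs q" "0 < lookup p \<beta>" "0 < lookup q \<delta>"
  shows "0 < lookup (p * q) (\<beta> + \<delta>)"
proof -
  let ?t = "\<lambda>\<beta>' \<delta>'. lookup (single (\<beta>' + \<delta>') (lookup p \<beta>' * lookup q \<delta>')) (\<beta> + \<delta>)"
  have nn: "0 \<le> ?t \<beta>' \<delta>'" for \<beta>' \<delta>'
    using assms(1,2) by (simp add: lookup_single when_def nonneg_coeffs_def)
  have k: "\<beta> \<in> keys p" "\<delta> \<in> keys q" using assms(3,4) by (auto simp: in_keys_iff)
  have "0 < ?t \<beta> \<delta>" using assms by simp
  also have "?t \<beta> \<delta> \<le> (\<Sum>\<delta>'\<in>keys q. ?t \<beta> \<delta>')"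
    by (rule member_le_sum [where f = "?t \<beta>"]) (use nn k in auto)
  also have "\<dots> \<le> (\<Sum>\<beta>'\<in>keys p. \<Sum>\<delta>'\<in>keys q. ?t \<beta>' \<delta>')"
    by (rule member_le_sum [where f = "\<lambda>\<beta>'. \<Sum>\<delta>'\<in>keys q. ?t \<beta>' \<delta>'"])
      (use nn k in \<open>auto intro!: sum_nonneg\<close>)
  finally show ?thesis by (simp add: mult_expand [of p q] lookup_sum)
qed

lemma peval_pos:
  assumes "nonneg_coeffs p" "p \<noteq> 0" "p \<in> polys X" "\<And>i. i \<in> X \<Longrightarrow> 0 < x i"
  shows "0 < peval x p"
proof -
  have "0 < lookup p \<beta> * mval x \<beta>" if \<beta>: "\<beta> \<in> keys p" for \<beta>
  proof (rule mult_pos_pos)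
    show "0 < lookup p \<beta>"
      using assms(1) \<beta> unfolding nonneg_coeffs_def in_keys_iff by (metis order_le_imp_less_or_eq)
    show "0 < mval x \<beta>"
      using \<beta> assms(3,4) by (intro mval_pos) (auto simp: polys_def exps_def)
  qed
  then show ?thesis
    unfolding peval_def using assms(2) by (intro sum_pos) auto
qed

section \<open>Quadratic forms\<close>

definition bval :: "'a set \<Rightarrow> ('a \<Rightarrow> 'a \<Rightarrow> real) \<Rightarrow> ('a \<Rightarrow> real) \<Rightarrow> ('a \<Rightarrow> real) \<Rightarrow> real" where
  "bval X B x y = (\<Sum>i\<in>X. \<Sum>j\<in>X. B i j * x i * y j)"

abbreviation qval :: "'a set \<Rightarrow> ('a \<Rightarrow> 'a \<Rightarrow> real) \<Rightarrow> ('a \<Rightarrow> real) \<Rightarrow> real" where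
  "qval X B x \<equiv> bval X B x x"

definition psd :: "'a set \<Rightarrow> ('a \<Rightarrow> 'a \<Rightarrow> real) \<Rightarrow> bool" where
  "psd X B \<longleftrightarrow> symmetric_on X B \<and> (\<forall>x. 0 \<le> qval X B x)"

lemma psd_nonneg: "psd X B \<Longrightarrow> 0 \<le> qval X B x"
  by (simp add: psd_def)

lemma psd_sym: "psd X B \<Longrightarrow> i \<in> X \<Longrightarrow> j \<in> X \<Longrightarrow> B i j = B j i"
  by (simp add: psd_def symmetric_on_def)

lemma peval_quad_form [simp]: "peval x (quad_form X M) = qval X M x"
  by (simp add: quad_form_def bval_def peval_sum peval_mult)

lemma quad_form_eq: "quad_form X M = (\<Sum>i\<in>X. \<Sum>j\<in>X. single (unit_exp i + unit_exp j) (M i j))"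
  by (simp add: quad_form_def const_def var_eq mult_single)

lemma quad_form_cong: "(\<And>i j. i \<in> X \<Longrightarrow> j \<in> X \<Longrightarrow> A i j = B i j) \<Longrightarrow> quad_form X A = quad_form X B"
  by (simp add: quad_form_def)

lemma quad_form_add: "quad_form X (\<lambda>i j. A i j + B i j) = quad_form X A + quad_form X B"
  by (simp add: quad_form_eq single_add sum.distrib)

lemma quad_form_diff: "quad_form X (\<lambda>i j. A i j - B i j) = quad_form X A - quad_form X B"
  by (simp add: quad_form_eq single_diff sum_subtractf)

lemma quad_form_scale: "quad_form X (\<lambda>i j. c * B i j) = const c * quad_form X B"
  by (simp add: quad_form_def const_mult sum_distrib_left mult.assoc)

lemma quad_form_rank_one: "(\<Sum>j\<in>X. const (b j) * var j)\<^sup>2 = quad_form X (\<lambda>i j. b i * b j)"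
  by (simp add: quad_form_def power2_eq_square sum_product const_mult mult_ac)

lemma quad_form_polys [intro]: "quad_form X M \<in> polys X"
  unfolding quad_form_def by (intro polys_sum polys_mult polys_var polys_const)

lemma homogeneous_quad_form: "homogeneous 2 (quad_form X M)"
  unfolding quad_form_eq
  by (intro homogeneous_sum) (auto simp: homogeneous_def deg_add)

lemma lookup_quad_form:
  assumes "finite X"
  shows "lookup (quad_form X M) \<delta> = (\<Sum>(i, j) | i \<in> X \<and> j \<in> X \<and> unit_exp i + unit_exp j = \<delta>. M i j)"
proof -
  have "lookup (quad_form X M) \<delta> = (\<Sum>(i, j)\<in>X \<times> X. if unit_exp i + unit_exp j = \<delta> then M i j else 0)"
    unfolding quad_form_eq
    by (simp add: lookup_sum lookup_single when_def sum.cartesian_product [symmetric])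
  also have "\<dots> = (\<Sum>(i, j) | i \<in> X \<and> j \<in> X \<and> unit_exp i + unit_exp j = \<delta>. M i j)"
    using assms by (intro sum.mono_neutral_cong_right) (auto split: if_splits)
  finally show ?thesis .
qed

lemma bval_sym: "symmetric_on X B \<Longrightarrow> bval X B x y = bval X B y x"
  unfolding bval_def by (subst sum.swap) (auto simp: symmetric_on_def mult_ac intro!: sum.cong)

lemma bval_add_left: "bval X B (\<lambda>i. x i + y i) z = bval X B x z + bval X B y z"
  by (simp add: bval_def algebra_simps sum.distrib)

lemma bval_add_right: "bval X B z (\<lambda>i. x i + y i) = bval X B z x + bval X B z y"
  by (simp add: bval_def algebra_simps sum.distrib)

lemma bval_scale_left: "bval X B (\<lambda>i. s * x i) z = s * bval X B x z"
  by (simp add: bval_def sum_distrib_left mult_ac)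

lemma bval_scale_right: "bval X B z (\<lambda>i. s * x i) = s * bval X B z x"
  by (simp add: bval_def sum_distrib_left mult_ac)

lemma qval_add:
  assumes "symmetric_on X B"
  shows "qval X B (\<lambda>i. x i + y i) = qval X B x + 2 * bval X B x y + qval X B y"
  using bval_sym [OF assms, of x y] by (simp add: bval_add_left bval_add_right)

lemma bval_unit_left:
  assumes "finite X" "i \<in> X"
  shows "bval X B (\<lambda>j. if j = i then 1 else 0) y = (\<Sum>j\<in>X. B i j * y j)"
proof -
  have "bval X B (\<lambda>j. if j = i then 1 else 0) y = (\<Sum>k\<in>X. if k = i then (\<Sum>j\<in>X. B i j * y j) else 0)"
    unfolding bval_def by (intro sum.cong) auto
  then show ?thesis using assms by simp
qed

lemma qval_unit:
  assumes "finite X" "i \<in> X"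
  shows "qval X B (\<lambda>j. if j = i then 1 else 0) = B i i"
  using assms by (simp add: bval_unit_left if_distrib cong: if_cong)

text \<open>
  A zero of a nonnegative quadratic form is a minimum, so the gradient vanishes there: the zeros of
  a positive semidefinite form are the kernel of its matrix.
\<close>

lemma psd_kernel:
  assumes "finite X" "psd X B" "qval X B x = 0" "i \<in> X"
  shows "(\<Sum>j\<in>X. B i j * x j) = 0"
proof (rule ccontr)
  define b c where "b = (\<Sum>j\<in>X. B i j * x j)" and "c = B i i"
  assume "(\<Sum>j\<in>X. B i j * x j) \<noteq> 0"
  then have b0: "b \<noteq> 0" by (simp add: b_def)
  let ?e = "\<lambda>j. if j = i then 1 else (0::real)"
  have c0: "0 \<le> c"
    using psd_nonneg [OF assms(2), of ?e] qval_unit [OF assms(1,4)] by (simp add: c_def)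
  have *: "0 \<le> 2 * t * b + t\<^sup>2 * c" for t
  proof -
    have sym: "symmetric_on X B" using assms(2) by (simp add: psd_def)
    have "0 \<le> qval X B (\<lambda>j. x j + t * ?e j)" by (rule psd_nonneg [OF assms(2)])
    also have "\<dots> = 2 * bval X B x (\<lambda>j. t * ?e j) + qval X B (\<lambda>j. t * ?e j)"
      unfolding qval_add [OF sym] assms(3) by simp
    also have "\<dots> = 2 * t * bval X B ?e x + t\<^sup>2 * qval X B ?e"
      unfolding bval_scale_left bval_scale_right bval_sym [OF sym, of x ?e]
      by (simp only: power2_eq_square mult.assoc)
    also have "\<dots> = 2 * t * b + t\<^sup>2 * c"
      using qval_unit [OF assms(1,4), of B] bval_unit_left [OF assms(1,4), of B x]
      by (simp only: b_def c_def)
    finally show ?thesis .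
  qed
  define d where "d = c + 1"
  have d: "0 < d" "c = d - 1" using c0 by (auto simp: d_def)
  have "d\<^sup>2 * (2 * (- b / d) * b + (- b / d)\<^sup>2 * c) = - (b\<^sup>2 * (c + 2))"
    using d(1) unfolding d(2) by (simp add: field_simps power2_eq_square)
  also have "\<dots> < 0" using b0 c0 by simp
  finally show False using mult_nonneg_nonneg [OF zero_le_power2 * [of "- b / d"], of d] by linarith
qed

section \<open>Sums of squares\<close>

lemma sos_polys: "\<sigma> \<in> sos X \<Longrightarrow> \<sigma> \<in> polys X"
  by (auto simp: sos_def)

lemma sos_mono: "X \<subseteq> Y \<Longrightarrow> sos X \<subseteq> sos Y"
  using polys_mono [of X Y] unfolding sos_def by blast

lemma sos_0 [simp]: "0 \<in> sos X"
  unfolding sos_def by (intro CollectI exI [of _ "0::nat"] exI [of _ "\<lambda>_. 0"]) simp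

lemma sos_add_square:
  assumes "\<sigma> \<in> sos X" "p \<in> polys X"
  shows "\<sigma> + p\<^sup>2 \<in> sos X"
proof -
  obtain m :: nat and q where q: "\<forall>j<m. q j \<in> polys X" "\<sigma> = (\<Sum>j<m. (q j)\<^sup>2)"
    using assms(1) by (auto simp: sos_def)
  have "\<forall>j<Suc m. (q(m := p)) j \<in> polys X" "\<sigma> + p\<^sup>2 = (\<Sum>j<Suc m. ((q(m := p)) j)\<^sup>2)"
    using q assms(2) by auto
  then show ?thesis unfolding sos_def by blast
qed

lemma sos_const: "0 \<le> c \<Longrightarrow> const c \<in> sos X"
  using sos_add_square [OF sos_0, of "const (sqrt c)" X]
  by (simp add: power2_eq_square flip: const_mult)

lemma quad_form_drop:
  assumes "finite X" "a \<notin> X" "\<And>i. i \<in> insert a X \<Longrightarrow> B i a = 0" "\<And>j. j \<in> insert a X \<Longrightarrow> B a j = 0"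
  shows "quad_form (insert a X) B = quad_form X B"
  using assms by (simp add: quad_form_eq)

lemma bval_drop:
  assumes "finite X" "a \<notin> X" "\<And>i. i \<in> insert a X \<Longrightarrow> B i a = 0" "\<And>j. j \<in> insert a X \<Longrightarrow> B a j = 0"
  shows "bval (insert a X) B x y = bval X B x y"
  using assms by (simp add: bval_def)

text \<open>Induction on the number of variables, completing the square in one of them.\<close>

lemma psd_sos: "finite X \<Longrightarrow> psd X B \<Longrightarrow> quad_form X B \<in> sos X"
proof (induction X arbitrary: B rule: finite_induct)
  case empty
  then show ?case by (simp add: quad_form_def)
next
  case (insert a X)
  have fin: "finite (insert a X)" using insert by simp
  have sym: "B i j = B j i" if "i \<in> insert a X" "j \<in> insert a X" for i j
    using psd_sym [OF insert.prems] that by blast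
  let ?e = "\<lambda>j. if j = a then 1 else (0::real)"
  have qe: "qval (insert a X) B ?e = B a a" using fin by (intro qval_unit) auto
  have nn: "0 \<le> B a a" using psd_nonneg [OF insert.prems, of ?e] qe by simp
  define b where "b j = B a j / sqrt (B a a)" for j
  define C where "C i j = B i j - b i * b j" for i j
  have C0: "C i a = 0" "C a i = 0" if "i \<in> insert a X" for i
  proof -
    have "B i a = 0" if "B a a = 0"
    proof -
      have "(\<Sum>j\<in>insert a X. B i j * ?e j) = 0"
        using psd_kernel [OF fin insert.prems _ \<open>i \<in> insert a X\<close>, of ?e] qe that by simp
      also have "(\<Sum>j\<in>insert a X. B i j * ?e j) = B i a"
        using insert.hyps fin by (simp add: if_distrib cong: if_cong)
      finally show ?thesis .
    qed
    moreover have "b i * b a = B i a" if "B a a \<noteq> 0"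
      using that nn sym [of a i] \<open>i \<in> insert a X\<close> by (simp add: b_def field_simps)
    ultimately show "C i a = 0" "C a i = 0"
      using sym [of a i] \<open>i \<in> insert a X\<close>
      by (cases "B a a = 0"; simp add: C_def b_def mult.commute)+
  qed
  have B: "B = (\<lambda>i j. b i * b j + C i j)" by (simp add: C_def)
  have split: "qval (insert a X) B x = (\<Sum>j\<in>insert a X. b j * x j)\<^sup>2 + qval X C x" for x
  proof -
    have "qval (insert a X) B x = peval x (quad_form (insert a X) (\<lambda>i j. b i * b j)) + qval (insert a X) C x"
      unfolding B by (simp add: bval_def algebra_simps sum.distrib)
    also have "qval (insert a X) C x = qval X C x"
      using insert.hyps C0 by (intro bval_drop) auto
    also have "peval x (quad_form (insert a X) (\<lambda>i j. b i * b j)) = (\<Sum>j\<in>insert a X. b j * x j)\<^sup>2"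
      unfolding quad_form_rank_one [symmetric] peval_power peval_sum peval_mult by simp
    finally show ?thesis .
  qed
  have "psd X C"
    unfolding psd_def
  proof (intro conjI allI)
    show "symmetric_on X C" using sym by (auto simp: symmetric_on_def C_def)
    fix x
    show "0 \<le> qval X C x"
    proof -
      \<comment> \<open>The value of the new variable is free; it is chosen such that the square vanishes.\<close>
      define y where "y = (\<lambda>j. if j = a then - (\<Sum>j\<in>X. b j * x j) / b a else x j)"
      have eq: "(\<Sum>j\<in>X. b j * y j) = (\<Sum>j\<in>X. b j * x j)"
        using insert.hyps by (intro sum.cong) (auto simp: y_def)
      have z: "b j = 0" if "b a = 0" for j using that nn by (auto simp: b_def)
      have "(\<Sum>j\<in>insert a X. b j * y j) = 0"
      proof (cases "b a = 0")
        case True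
        then show ?thesis using z by simp
      next
        case False
        have "(\<Sum>j\<in>insert a X. b j * y j) = b a * y a + (\<Sum>j\<in>X. b j * y j)"
          using insert.hyps by simp
        also have "\<dots> = 0" unfolding eq using False by (simp add: y_def)
        finally show ?thesis .
      qed
      then have "0 \<le> qval X C y"
        using split [of y] psd_nonneg [OF insert.prems, of y] by simp
      also have "qval X C y = qval X C x"
        unfolding bval_def using insert.hyps by (intro sum.cong) (auto simp: y_def)
      finally show ?thesis .
    qed
  qed
  then have "quad_form X C \<in> sos (insert a X)"
    using insert.IH sos_mono [of X "insert a X"] by blast
  then have "quad_form X C + (\<Sum>j\<in>insert a X. const (b j) * var j)\<^sup>2 \<in> sos (insert a X)"
    by (intro sos_add_square polys_sum polys_mult polys_var polys_const)
  moreover have "quad_form (insert a X) B = quad_form X C + (\<Sum>j\<in>insert a X. const (b j) * var j)\<^sup>2"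
  proof -
    have "quad_form (insert a X) C = quad_form X C"
      using insert.hyps C0 by (intro quad_form_drop) auto
    then show ?thesis
      by (subst B) (simp only: quad_form_add quad_form_rank_one add.commute)
  qed
  ultimately show ?case by simp
qed

text \<open>
  The coefficient of a sum of squares at a monomial of degree 2 is spread evenly over the pairs
  of variables whose product is that monomial.
\<close>

definition gram :: "'a set \<Rightarrow> 'a rpoly \<Rightarrow> 'a \<Rightarrow> 'a \<Rightarrow> real" where
  "gram X \<sigma> i j = lookup \<sigma> (unit_exp i + unit_exp j) /
     real (card {(i', j'). i' \<in> X \<and> j' \<in> X \<and> unit_exp i' + unit_exp j' = unit_exp i + unit_exp j})"

lemma degree_le_minus_gram:
  assumes "finite X" "\<sigma> \<in> polys X" "degree_le 2 \<sigma>"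
  shows "degree_le 1 (\<sigma> - quad_form X (gram X \<sigma>))"
  unfolding degree_le_iff
proof (intro allI impI, rule ccontr)
  fix \<delta>
  assume nz: "lookup (\<sigma> - quad_form X (gram X \<sigma>)) \<delta> \<noteq> 0" and "\<not> deg \<delta> \<le> 1"
  have "degree_le 2 (quad_form X (gram X \<sigma>))"
    by (rule degree_le_homogeneous [OF homogeneous_quad_form])
  then have 2: "deg \<delta> = 2"
    using nz assms(3) \<open>\<not> deg \<delta> \<le> 1\<close>
    by (auto simp: degree_le_iff lookup_minus) (metis diff_zero le_antisym not_less_eq_eq numeral_2_eq_2 One_nat_def)
  let ?S = "{(i', j'). i' \<in> X \<and> j' \<in> X \<and> unit_exp i' + unit_exp j' = \<delta>}"
  have fin: "finite ?S" by (rule finite_subset [of _ "X \<times> X"]) (use assms(1) in auto)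
  have "lookup (quad_form X (gram X \<sigma>)) \<delta> = (\<Sum>(i, j)\<in>?S. lookup \<sigma> \<delta> / real (card ?S))"
    unfolding lookup_quad_form [OF assms(1)] by (intro sum.cong) (auto simp: gram_def)
  also have "\<dots> = lookup \<sigma> \<delta>"
  proof (cases "\<delta> \<in> exps X")
    case True
    obtain i \<delta>' where 1: "i \<in> X" "\<delta>' \<in> exps X" "deg \<delta>' = 1" "\<delta> = unit_exp i + \<delta>'"
      using exps_split [of \<delta> 1] True 2 by auto
    obtain j \<delta>'' where 2: "j \<in> X" "deg \<delta>'' = 0" "\<delta>' = unit_exp j + \<delta>''"
      using exps_split [of \<delta>' 0 X] 1(2,3) unfolding One_nat_def by metis
    have "\<delta> = unit_exp i + unit_exp j" unfolding 1(4) 2(3) using 2(2) by (simp only: deg_eq_0_iff add_0_right)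
    then have "(i, j) \<in> ?S" using 1(1) 2(1) by simp
    then have "?S \<noteq> {}" by blast
    then have "card ?S \<noteq> 0" using fin by (simp only: card_0_eq not_False_eq_True)
    then show ?thesis by simp
  next
    case False
    then show ?thesis using assms(2) by (auto simp: polys_iff case_prod_beta)
  qed
  finally show False using nz by (simp add: lookup_minus)
qed

text \<open>
  The leading form of a nonnegative polynomial of degree 2 is nonnegative, because it dominates
  far from the origin. Averaging over \<open>x\<close> and \<open>-x\<close> removes the linear part.
\<close>

lemma psd_gram:
  assumes "finite X" "\<sigma> \<in> sos X" "degree_le 2 \<sigma>"
  shows "psd X (gram X \<sigma>)"
  unfolding psd_def
proof (intro conjI allI)
  show "symmetric_on X (gram X \<sigma>)" by (simp add: symmetric_on_def gram_def add.commute)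
  fix x
  define L where "L = \<sigma> - quad_form X (gram X \<sigma>)"
  define Q where "Q = qval X (gram X \<sigma>) x"
  have L: "degree_le 1 L"
    unfolding L_def using degree_le_minus_gram assms sos_polys by blast
  have \<sigma>: "\<sigma> = quad_form X (gram X \<sigma>) + L" by (simp add: L_def)
  have even: "peval (\<lambda>i. s * x i) L + peval (\<lambda>i. - s * x i) L = 2 * lookup L 0" for s
  proof -
    have "peval (\<lambda>i. s * x i) L + peval (\<lambda>i. - s * x i) L =
        (\<Sum>\<beta>\<in>keys L. lookup L \<beta> * (s ^ deg \<beta> + (- s) ^ deg \<beta>) * mval x \<beta>)"
      unfolding peval_def mval_scale by (simp add: algebra_simps sum.distrib)
    also have "\<dots> = (\<Sum>\<beta>\<in>keys L. if \<beta> = 0 then 2 * lookup L 0 else 0)"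
    proof (intro sum.cong refl)
      fix \<beta> assume "\<beta> \<in> keys L"
      then have "deg \<beta> \<le> 1" using L by (auto simp: degree_le_def)
      then have "deg \<beta> = 0 \<or> deg \<beta> = 1" by linarith
      then show "lookup L \<beta> * (s ^ deg \<beta> + (- s) ^ deg \<beta>) * mval x \<beta> = (if \<beta> = 0 then 2 * lookup L 0 else 0)"
        by (auto simp: deg_eq_0_iff)
    qed
    also have "\<dots> = 2 * lookup L 0" by (simp add: in_keys_iff)
    finally show ?thesis .
  qed
  have "0 \<le> s\<^sup>2 * Q + lookup L 0" for s
  proof -
    have "0 \<le> peval (\<lambda>i. s * x i) \<sigma> + peval (\<lambda>i. - s * x i) \<sigma>"
      using peval_sos_nonneg [OF assms(2)] by (intro add_nonneg_nonneg) auto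
    also have "\<dots> = qval X (gram X \<sigma>) (\<lambda>i. s * x i) + qval X (gram X \<sigma>) (\<lambda>i. - s * x i)
        + (peval (\<lambda>i. s * x i) L + peval (\<lambda>i. - s * x i) L)"
      by (subst (1 2) \<sigma>) (simp add: peval_add)
    also have "\<dots> = 2 * (s\<^sup>2 * Q + lookup L 0)"
      unfolding even bval_scale_left bval_scale_right Q_def by (simp add: power2_eq_square)
    finally show ?thesis by simp
  qed
  note * = this
  show "0 \<le> qval X (gram X \<sigma>) x"
  proof (rule ccontr)
    assume "\<not> 0 \<le> qval X (gram X \<sigma>) x"
    then have "Q < 0" by (simp add: Q_def)
    define c where "c = lookup L 0"
    have "0 \<le> c" using * [of 0] by (simp add: c_def)
    have "(sqrt ((c + 1) / - Q))\<^sup>2 = (c + 1) / - Q"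
      using \<open>Q < 0\<close> \<open>0 \<le> c\<close> by (intro real_sqrt_pow2 divide_nonneg_pos) auto
    then have "0 \<le> (c + 1) / - Q * Q + c" using * [of "sqrt ((c + 1) / - Q)"] by (simp add: c_def)
    then show False using \<open>Q < 0\<close> by simp
  qed
qed

section \<open>Certificates with Gram matrices\<close>

definition mons :: "'a set \<Rightarrow> nat \<Rightarrow> 'a expvec set" where
  "mons X d = {\<beta> \<in> exps X. deg \<beta> = d}"

lemma finite_mons: "finite X \<Longrightarrow> finite (mons X d)"
  using finite_exps_deg [of X "{d}"] by (simp add: mons_def)

text \<open>
  An element of the cone in normal form: \<open>B \<beta>\<close> is the Gram matrix of the quadratic form that multiplies
  the monomial \<open>\<beta>\<close>.
\<close>

definition cert :: "'a set \<Rightarrow> nat \<Rightarrow> ('a expvec \<Rightarrow> 'a \<Rightarrow> 'a \<Rightarrow> real) \<Rightarrow> ('a expvec \<Rightarrow> real) \<Rightarrow> 'a rpoly" where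
  "cert X r B c = (\<Sum>\<beta>\<in>mons X r. mono_power \<beta> * quad_form X (B \<beta>)) +
     (\<Sum>\<gamma>\<in>mons X (r + 2). mono_power \<gamma> * const (c \<gamma>))"

definition valid_cert :: "'a set \<Rightarrow> nat \<Rightarrow> ('a expvec \<Rightarrow> 'a \<Rightarrow> 'a \<Rightarrow> real) \<Rightarrow> ('a expvec \<Rightarrow> real) \<Rightarrow> bool" where
  "valid_cert X r B c \<longleftrightarrow> (\<forall>\<beta>\<in>mons X r. psd X (B \<beta>)) \<and> (\<forall>\<gamma>\<in>mons X (r + 2). 0 \<le> c \<gamma>)"

lemma polys_mono_power [intro]: "\<beta> \<in> mons X d \<Longrightarrow> mono_power \<beta> \<in> polys X"
  by (auto simp: mono_power_eq_single mons_def)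

lemma homogeneous_mono_power: "\<beta> \<in> mons X d \<Longrightarrow> homogeneous d (mono_power \<beta>)"
  using homogeneous_single [of \<beta> 1] by (auto simp: mono_power_eq_single mons_def)

lemma cert_polys: "cert X r B c \<in> polys X"
  unfolding cert_def by (intro polys_add polys_sum polys_mult polys_mono_power quad_form_polys polys_const)

lemma homogeneous_cert: "homogeneous (r + 2) (cert X r B c)"
proof -
  have "homogeneous (r + 2) (mono_power \<gamma> * const a)" if "\<gamma> \<in> mons X (r + 2)" for \<gamma> a
    using homogeneous_mult [OF homogeneous_mono_power [OF that] homogeneous_const] by simp
  moreover have "homogeneous (r + 2) (mono_power \<beta> * quad_form X M)" if "\<beta> \<in> mons X r" for \<beta> M
    by (rule homogeneous_mult [OF homogeneous_mono_power [OF that] homogeneous_quad_form])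
  ultimately show ?thesis
    unfolding cert_def by (intro homogeneous_add homogeneous_sum) blast+
qed

lemma sum_Hcone_split:
  assumes "finite X"
  shows "(\<Sum>\<beta> | \<beta> \<in> exps X \<and> deg \<beta> \<in> {r, r + 2}. F \<beta>) = (\<Sum>\<beta>\<in>mons X r. F \<beta>) + (\<Sum>\<beta>\<in>mons X (r + 2). F \<beta>)"
proof -
  have "{\<beta>. \<beta> \<in> exps X \<and> deg \<beta> \<in> {r, r + 2}} = mons X r \<union> mons X (r + 2)"
    by (auto simp: mons_def)
  then show ?thesis
    using finite_mons [OF assms] by (simp only:) (rule sum.union_disjoint, auto simp: mons_def)
qed

lemma degree_le_0_const:
  assumes "degree_le 0 \<sigma>"
  shows "\<sigma> = const (lookup \<sigma> 0)"
proof (rule poly_mapping_eqI)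
  fix \<beta>
  show "lookup \<sigma> \<beta> = lookup (const (lookup \<sigma> 0)) \<beta>"
    using assms by (cases "\<beta> = 0") (auto simp: const_def lookup_single when_def degree_le_iff deg_eq_0_iff)
qed

lemma degree_le_add: "degree_le d p \<Longrightarrow> degree_le d q \<Longrightarrow> degree_le d (p + q)"
  using keys_add [of p q] by (auto simp: degree_le_def)

lemma degree_le_sum: "(\<And>i. i \<in> A \<Longrightarrow> degree_le d (f i)) \<Longrightarrow> degree_le d (\<Sum>i\<in>A. f i)"
  by (induction A rule: infinite_finite_induct) (auto intro: degree_le_add, auto simp: degree_le_def)

lemma degree_le_mult: "degree_le d p \<Longrightarrow> degree_le e q \<Longrightarrow> degree_le (d + e) (p * q)"
  using keys_mult [of p q] by (fastforce simp: degree_le_def deg_add intro: add_mono)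

lemma homogeneous_low_0:
  assumes "homogeneous d p" "degree_le e p" "e < d"
  shows "p = 0"
proof (rule poly_mapping_eqI)
  fix \<beta> show "lookup p \<beta> = lookup 0 \<beta>"
    using assms by (auto simp: homogeneous_iff degree_le_iff)
qed

text \<open>
  A sum of squares of degree at most 2 is its leading form plus a part of degree at most 1. The lower
  parts contribute only to degrees below \<open>r + 2\<close>, and their total is homogeneous of degree \<open>r + 2\<close>, so
  it is zero and the leading forms alone represent the polynomial.
\<close>

theorem Hcone_iff_cert:
  assumes fin: "finite X"
  shows "f \<in> Hcone X r \<longleftrightarrow> (\<exists>B c. valid_cert X r B c \<and> f = cert X r B c)"
proof
  assume f: "f \<in> Hcone X r"
  then obtain \<sigma> where \<sigma>: "\<And>\<beta>. \<beta> \<in> exps X \<Longrightarrow> deg \<beta> \<in> {r, r + 2} \<Longrightarrow> \<sigma> \<beta> \<in> sos X \<and> degree_le (r + 2 - deg \<beta>) (\<sigma> \<beta>)"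
    and f_eq: "f = (\<Sum>\<beta> | \<beta> \<in> exps X \<and> deg \<beta> \<in> {r, r + 2}. mono_power \<beta> * \<sigma> \<beta>)"
    and hom: "homogeneous (r + 2) f"
    unfolding Hcone_def by blast
  have \<sigma>1: "\<sigma> \<beta> \<in> sos X" "degree_le 2 (\<sigma> \<beta>)" if "\<beta> \<in> mons X r" for \<beta>
    using \<sigma> [of \<beta>] that by (auto simp: mons_def)
  have \<sigma>2: "\<sigma> \<gamma> \<in> sos X" "degree_le 0 (\<sigma> \<gamma>)" if "\<gamma> \<in> mons X (r + 2)" for \<gamma>
    using \<sigma> [of \<gamma>] that by (auto simp: mons_def)
  define B where "B \<beta> = gram X (\<sigma> \<beta>)" for \<beta>
  define c where "c \<gamma> = lookup (\<sigma> \<gamma>) 0" for \<gamma>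
  define L where "L = (\<Sum>\<beta>\<in>mons X r. mono_power \<beta> * (\<sigma> \<beta> - quad_form X (B \<beta>)))"
  have const: "\<sigma> \<gamma> = const (c \<gamma>)" if "\<gamma> \<in> mons X (r + 2)" for \<gamma>
    unfolding c_def using degree_le_0_const \<sigma>2 that by blast
  have f_split: "f = cert X r B c + L"
    unfolding f_eq sum_Hcone_split [OF fin] cert_def L_def
    using const by (simp add: right_diff_distrib sum_subtractf)
  have "degree_le (r + 1) L"
    unfolding L_def B_def
    using degree_le_minus_gram [OF fin] \<sigma>1 sos_polys
    by (intro degree_le_sum degree_le_mult degree_le_homogeneous [OF homogeneous_mono_power]) blast+
  moreover have "homogeneous (r + 2) L"
    using homogeneous_diff [OF hom homogeneous_cert, of X B c] f_split by simp
  ultimately have "L = 0" using homogeneous_low_0 [of "r + 2" L "r + 1"] by simp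
  moreover have "valid_cert X r B c"
    unfolding valid_cert_def B_def
  proof (intro conjI ballI)
    fix \<gamma> assume "\<gamma> \<in> mons X (r + 2)"
    then show "0 \<le> c \<gamma>" using const [of \<gamma>] peval_sos_nonneg [of "\<sigma> \<gamma>" X] \<sigma>2 by (metis peval_const)
  qed (use psd_gram [OF fin] \<sigma>1 in blast)
  ultimately show "\<exists>B c. valid_cert X r B c \<and> f = cert X r B c" using f_split by auto
next
  assume "\<exists>B c. valid_cert X r B c \<and> f = cert X r B c"
  then obtain B c where v: "valid_cert X r B c" and f: "f = cert X r B c" by blast
  define \<sigma> where "\<sigma> \<beta> = (if deg \<beta> = r then quad_form X (B \<beta>) else const (c \<beta>))" for \<beta>
  have "\<sigma> \<beta> \<in> sos X \<and> degree_le (r + 2 - deg \<beta>) (\<sigma> \<beta>)" if "\<beta> \<in> exps X" "deg \<beta> \<in> {r, r + 2}" for \<beta>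
    using that v psd_sos [OF fin] degree_le_homogeneous [OF homogeneous_quad_form, of X "B \<beta>"]
      degree_le_homogeneous [OF homogeneous_const, of "c \<beta>"] sos_const [of "c \<beta>" X]
    by (auto simp: \<sigma>_def valid_cert_def mons_def)
  moreover have "f = (\<Sum>\<beta> | \<beta> \<in> exps X \<and> deg \<beta> \<in> {r, r + 2}. mono_power \<beta> * \<sigma> \<beta>)"
    unfolding f cert_def sum_Hcone_split [OF fin]
    by (intro arg_cong2 [of _ _ _ _ "(+)"] sum.cong) (auto simp: \<sigma>_def mons_def)
  ultimately show "f \<in> Hcone X r"
    unfolding Hcone_def using cert_polys [of X r B c] homogeneous_cert [of r X B c] unfolding f by blast
qed

lemma peval_cert:
  "peval x (cert X r B c) = (\<Sum>\<beta>\<in>mons X r. mval x \<beta> * qval X (B \<beta>) x) + (\<Sum>\<gamma>\<in>mons X (r + 2). mval x \<gamma> * c \<gamma>)"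
  by (simp add: cert_def peval_add peval_sum peval_mult)

section \<open>Building certificates\<close>

lemma poly_eq_sum_mons:
  assumes "finite X" "f \<in> polys X" "homogeneous d f"
  shows "f = (\<Sum>\<gamma>\<in>mons X d. mono_power \<gamma> * const (lookup f \<gamma>))"
proof -
  have "f = (\<Sum>\<gamma>\<in>keys f. single \<gamma> (lookup f \<gamma>))" by (rule poly_mapping_expand)
  also have "\<dots> = (\<Sum>\<gamma>\<in>mons X d. single \<gamma> (lookup f \<gamma>))"
    using assms finite_mons [OF assms(1), of d]
    by (intro sum.mono_neutral_left) (auto simp: mons_def polys_def homogeneous_def in_keys_iff)
  finally show ?thesis by (simp add: mono_power_eq_single const_def mult_single)
qed

lemma Hcone_add:
  assumes "finite X" "f \<in> Hcone X r" "g \<in> Hcone X r"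
  shows "f + g \<in> Hcone X r"
proof -
  obtain B c B' c' where v: "valid_cert X r B c" "f = cert X r B c" "valid_cert X r B' c'" "g = cert X r B' c'"
    using assms by (auto simp: Hcone_iff_cert)
  let ?B = "\<lambda>\<beta> i j. B \<beta> i j + B' \<beta> i j" and ?c = "\<lambda>\<gamma>. c \<gamma> + c' \<gamma>"
  have "bval X (\<lambda>i j. B \<beta> i j + B' \<beta> i j) x y = bval X (B \<beta>) x y + bval X (B' \<beta>) x y" for \<beta> x y
    by (simp add: bval_def algebra_simps sum.distrib)
  then have "valid_cert X r ?B ?c"
    using v(1,3) by (auto simp: valid_cert_def psd_def symmetric_on_def)
  moreover have "f + g = cert X r ?B ?c"
    unfolding v(2,4) cert_def quad_form_add const_add by (simp add: algebra_simps sum.distrib)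
  ultimately show ?thesis using assms(1) Hcone_iff_cert by blast
qed

lemma Hcone_0 [simp]: "finite X \<Longrightarrow> 0 \<in> Hcone X r"
  unfolding Hcone_iff_cert
  by (intro exI [of _ "\<lambda>_ _ _. 0"] exI [of _ "\<lambda>_. 0"])
    (simp add: valid_cert_def psd_def symmetric_on_def bval_def cert_def quad_form_def)

lemma Hcone_sum: "finite X \<Longrightarrow> (\<And>i. i \<in> A \<Longrightarrow> f i \<in> Hcone X r) \<Longrightarrow> (\<Sum>i\<in>A. f i) \<in> Hcone X r"
  by (induction A rule: infinite_finite_induct) (auto intro: Hcone_add)

lemma Hcone_nonneg:
  assumes "finite X" "f \<in> polys X" "homogeneous (r + 2) f" "nonneg_coeffs f"
  shows "f \<in> Hcone X r"
proof -
  have "valid_cert X r (\<lambda>_ _ _. 0) (lookup f)"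
    using assms(4) by (simp add: valid_cert_def nonneg_coeffs_def psd_def symmetric_on_def bval_def)
  moreover have "f = cert X r (\<lambda>_ _ _. 0) (lookup f)"
    using poly_eq_sum_mons [OF assms(1-3)] by (simp add: cert_def quad_form_def)
  ultimately show ?thesis using assms(1) Hcone_iff_cert by blast
qed

lemma Hcone_mult_psd:
  assumes "finite X" "p \<in> polys X" "homogeneous r p" "nonneg_coeffs p" "psd X Q"
  shows "p * quad_form X Q \<in> Hcone X r"
proof -
  let ?B = "\<lambda>\<beta> i j. lookup p \<beta> * Q i j"
  have "bval X (\<lambda>i j. a * Q i j) x y = a * bval X Q x y" for a x y
    by (simp add: bval_def sum_distrib_left mult_ac)
  then have "valid_cert X r ?B (\<lambda>_. 0)"
    using assms(4,5) by (auto simp: valid_cert_def psd_def symmetric_on_def nonneg_coeffs_def)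
  moreover have "p * quad_form X Q = cert X r ?B (\<lambda>_. 0)"
    by (subst poly_eq_sum_mons [OF assms(1-3)])
      (simp add: cert_def quad_form_scale sum_distrib_right mult.assoc)
  ultimately show ?thesis using assms(1) Hcone_iff_cert by blast
qed

text \<open>
  Cauchy-Schwarz for the sums of \<open>x\<close> over the classes of a partition into \<open>card C\<close> classes.
\<close>

lemma psd_partition:
  assumes "finite X" "finite C" "f ` X \<subseteq> C"
  shows "psd X (\<lambda>i j. real (card C) * (if f i = f j then 1 else 0) - 1)"
  unfolding psd_def
proof (intro conjI allI)
  show "symmetric_on X (\<lambda>i j. real (card C) * (if f i = f j then 1 else 0) - 1)"
    by (auto simp: symmetric_on_def)
  fix x :: "'a \<Rightarrow> real"
  define y where "y c = (\<Sum>i | i \<in> X \<and> f i = c. x i)" for c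
  have sum_y: "(\<Sum>c\<in>C. y c) = (\<Sum>i\<in>X. x i)"
    unfolding y_def by (rule sum.group [OF assms])
  have "(\<Sum>c\<in>C. (y c)\<^sup>2) = (\<Sum>c\<in>C. \<Sum>i | i \<in> X \<and> f i = c. x i * y (f i))"
    by (simp add: power2_eq_square y_def sum_distrib_right)
  also have "\<dots> = (\<Sum>i\<in>X. x i * y (f i))" by (rule sum.group [OF assms])
  also have "\<dots> = (\<Sum>i\<in>X. \<Sum>j\<in>X. (if f i = f j then 1 else 0) * x i * x j)"
    unfolding y_def sum_distrib_left using assms(1)
    by (intro sum.cong refl sum.mono_neutral_cong_left) auto
  finally have sq: "(\<Sum>c\<in>C. (y c)\<^sup>2) = (\<Sum>i\<in>X. \<Sum>j\<in>X. (if f i = f j then 1 else 0) * x i * x j)" .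
  have "qval X (\<lambda>i j. real (card C) * (if f i = f j then 1 else 0) - 1) x
      = real (card C) * (\<Sum>c\<in>C. (y c)\<^sup>2) - (\<Sum>c\<in>C. y c)\<^sup>2"
    unfolding sq sum_y power2_eq_square [of "\<Sum>i\<in>X. x i"] sum_product bval_def
    by (simp add: left_diff_distrib sum_subtractf sum_distrib_left mult.assoc)
  then show "0 \<le> qval X (\<lambda>i j. real (card C) * (if f i = f j then 1 else 0) - 1) x"
    using sum_squared_le_sum_of_squares [of y C] by (simp add: mult.commute)
qed

section \<open>The matrices of a graph\<close>

definition closed_adj :: "'a graph \<Rightarrow> 'a \<Rightarrow> 'a \<Rightarrow> real" where
  "closed_adj G i j = adjacency G i j + (if i = j then 1 else 0)"

definition ind :: "'a set \<Rightarrow> 'a \<Rightarrow> real" where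
  "ind S i = (if i \<in> S then 1 else 0)"

lemma closed_adj_nonneg: "0 \<le> closed_adj G i j"
  by (simp add: closed_adj_def adjacency_def)

lemma symmetric_graph_matrix: "symmetric_on X (graph_matrix G t)"
  by (auto simp: symmetric_on_def graph_matrix_def adjacency_def insert_commute)

lemma quad_form_graph_matrix:
  "quad_form X (graph_matrix G t) = const t * quad_form X (closed_adj G) - (\<Sum>i\<in>X. var i)\<^sup>2"
proof -
  have "(\<Sum>i\<in>X. var i)\<^sup>2 = quad_form X (\<lambda>i j. 1)"
    using quad_form_rank_one [of "\<lambda>_. 1" X] by simp
  moreover have "graph_matrix G t = (\<lambda>i j. t * closed_adj G i j - 1)"
    by (simp add: graph_matrix_def closed_adj_def fun_eq_iff)
  ultimately show ?thesis by (simp add: quad_form_diff quad_form_scale)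
qed

lemma qval_graph_matrix: "qval X (graph_matrix G t) x = t * qval X (closed_adj G) x - (\<Sum>i\<in>X. x i)\<^sup>2"
proof -
  have "peval x (const t * quad_form X (closed_adj G) + - 1 * (\<Sum>i\<in>X. var i)\<^sup>2) =
      t * qval X (closed_adj G) x + peval x (- 1) * (\<Sum>i\<in>X. x i)\<^sup>2"
    by (simp only: peval_add peval_mult peval_const peval_quad_form peval_power peval_sum peval_var)
  moreover have "peval x (- 1) = - 1" using peval_add [of x 1 "- 1"] by simp
  ultimately show ?thesis
    using peval_quad_form [of x X "graph_matrix G t"] by (simp add: quad_form_graph_matrix)
qed

lemma sum_ind: "finite X \<Longrightarrow> S \<subseteq> X \<Longrightarrow> (\<Sum>i\<in>X. ind S i * f i) = (\<Sum>i\<in>S. f i)"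
  unfolding ind_def by (subst sum.mono_neutral_cong_right [of X S]) (auto)

lemma bval_ind:
  assumes "finite X" "S \<subseteq> X"
  shows "bval X B x (ind S) = (\<Sum>j\<in>S. \<Sum>i\<in>X. B i j * x i)"
proof -
  have "bval X B x (ind S) = (\<Sum>j\<in>X. ind S j * (\<Sum>i\<in>X. B i j * x i))"
    unfolding bval_def by (subst sum.swap) (simp add: sum_distrib_left mult_ac)
  then show ?thesis using sum_ind [OF assms] by simp
qed

lemma stable_finite: "simple_graph G \<Longrightarrow> stable G S \<Longrightarrow> finite S"
  by (auto simp: simple_graph_def stable_def intro: finite_subset)

lemma stable_closed_adj:
  assumes "stable G S" "i \<in> S" "j \<in> S"
  shows "closed_adj G i j = (if i = j then 1 else 0)"
  using assms by (simp add: stable_def closed_adj_def adjacency_def)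

lemma qval_stable:
  assumes "simple_graph G" "stable G S"
  shows "qval (verts G) (closed_adj G) (ind S) = card S" "(\<Sum>i\<in>verts G. ind S i) = card S"
proof -
  have fin: "finite (verts G)" and S: "S \<subseteq> verts G" using assms by (auto simp: simple_graph_def stable_def)
  have "qval (verts G) (closed_adj G) (ind S) = (\<Sum>j\<in>S. \<Sum>i\<in>verts G. ind S i * closed_adj G i j)"
    using bval_ind [OF fin S] by (simp add: mult.commute)
  also have "\<dots> = (\<Sum>j\<in>S. \<Sum>i\<in>S. closed_adj G i j)"
    using sum_ind [OF fin S] by simp
  also have "\<dots> = (\<Sum>j\<in>S. \<Sum>i\<in>S. if i = j then 1 else 0)"
    using stable_closed_adj [OF assms(2)] by (intro sum.cong) auto
  also have "\<dots> = card S" using stable_finite [OF assms] by simp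
  finally show "qval (verts G) (closed_adj G) (ind S) = card S" .
  show "(\<Sum>i\<in>verts G. ind S i) = card S"
    using sum_ind [OF fin S, of "\<lambda>_. 1"] by simp
qed

lemma finite_stable_sets:
  assumes "simple_graph G"
  shows "finite {S. stable G S}"
proof (rule finite_subset)
  show "{S. stable G S} \<subseteq> Pow (verts G)" unfolding stable_def by blast
  show "finite (Pow (verts G))" using assms by (simp add: simple_graph_def)
qed

lemma card_stable_le:
  assumes "simple_graph G" "stable G S"
  shows "card S \<le> stability_number G"
  unfolding stability_number_def
  by (rule Max_ge) (use finite_stable_sets [OF assms(1)] assms(2) in blast)+

lemma stability_number_attained:
  assumes "simple_graph G"
  obtains S where "stable G S" "card S = stability_number G"
proof -
  have "stable G {}" by (simp add: stable_def)
  then have "card ` {S. stable G S} \<noteq> {}" by blast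
  then have "stability_number G \<in> card ` {S. stable G S}"
    unfolding stability_number_def using finite_stable_sets [OF assms] by (intro Max_in finite_imageI)
  then show thesis using that by auto
qed

section \<open>Lower bounds from stable sets\<close>

lemma peval_cert_nonneg:
  assumes "valid_cert X r B c" "\<And>i. i \<in> X \<Longrightarrow> 0 \<le> x i"
  shows "0 \<le> peval x (cert X r B c)"
  unfolding peval_cert
  using assms by (intro add_nonneg_nonneg sum_nonneg mult_nonneg_nonneg mval_nonneg)
    (auto simp: valid_cert_def mons_def exps_def intro: psd_nonneg)

text \<open>
  The multiplier may vanish at the indicator vector of \<open>S\<close>, but it is positive at every strictly
  positive point nearby.
\<close>

lemma stable_lower_bound:
  assumes G: "simple_graph G" and p: "nonneg_coeffs p" "p \<noteq> 0" "p \<in> polys (verts G)"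
    and H: "p * quad_form (verts G) (graph_matrix G t) \<in> Hcone (verts G) r"
    and S: "stable G S" "S \<noteq> {}"
  shows "real (card S) \<le> t"
proof -
  let ?X = "verts G" and ?M = "graph_matrix G t"
  have fin: "finite ?X" using G by (simp add: simple_graph_def)
  obtain B c where v: "valid_cert ?X r B c" and eq: "p * quad_form ?X ?M = cert ?X r B c"
    using H fin by (auto simp: Hcone_iff_cert)
  define b where "b = bval ?X ?M (ind S) (\<lambda>_. 1)"
  define d where "d = qval ?X ?M (\<lambda>_. 1)"
  have "0 \<le> qval ?X ?M (ind S) + 2 * e * b + e * e * d" if e: "0 < e" for e
  proof -
    define x where "x i = ind S i + e * 1" for i
    have pos: "0 < x i" for i using e by (simp add: x_def ind_def)
    have "0 \<le> peval x (p * quad_form ?X ?M)"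
      unfolding eq using pos by (intro peval_cert_nonneg [OF v] less_imp_le)
    then have "0 \<le> qval ?X ?M x"
      using peval_pos [OF p, of x] pos by (simp add: peval_mult zero_le_mult_iff)
    also have "qval ?X ?M x = qval ?X ?M (ind S) + 2 * e * b + e * e * d"
      unfolding x_def qval_add [OF symmetric_graph_matrix] bval_scale_left bval_scale_right b_def d_def by simp
    finally show ?thesis .
  qed
  then have "\<forall>\<^sub>F e in at_right 0. 0 \<le> qval ?X ?M (ind S) + 2 * e * b + e * e * d"
    using eventually_at_right_less [of "0::real"] by (auto elim: eventually_mono)
  moreover have "((\<lambda>e. qval ?X ?M (ind S) + 2 * e * b + e * e * d) \<longlongrightarrow> qval ?X ?M (ind S)) (at_right 0)"
    by (auto intro!: tendsto_eq_intros)
  ultimately have "0 \<le> qval ?X ?M (ind S)"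
    by (intro tendsto_lowerbound) auto
  also have "\<dots> = real (card S) * (t - real (card S))"
    by (simp add: qval_graph_matrix qval_stable [OF G S(1)] power2_eq_square algebra_simps)
  finally show ?thesis
    using S(2) stable_finite [OF G S(1)] by (simp add: zero_le_mult_iff card_eq_0_iff)
qed

lemma homogeneous_sum_var: "homogeneous 1 (\<Sum>i\<in>X. var i)"
  by (intro homogeneous_sum homogeneous_var)

lemma homogeneous_sum_var_power: "homogeneous r ((\<Sum>i\<in>X. var i) ^ r)"
  using homogeneous_power [OF homogeneous_sum_var, of r] by simp

lemma sum_var_power_polys [intro]: "(\<Sum>i\<in>X. var i) ^ r \<in> polys X"
  by (intro polys_power polys_sum polys_var)

lemma nonneg_coeffs_sum_var_power [intro]: "nonneg_coeffs ((\<Sum>i\<in>X. var i) ^ r)"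
  by (intro nonneg_coeffs_power nonneg_coeffs_sum nonneg_coeffs_var)

lemma sum_var_power_neq_0:
  assumes "finite X" "X \<noteq> {}"
  shows "(\<Sum>i\<in>X. var i) ^ r \<noteq> 0"
proof -
  have "peval (\<lambda>_. 1) ((\<Sum>i\<in>X. var i) ^ r) = real (card X) ^ r"
    by (simp add: peval_power peval_sum)
  then show ?thesis using assms by (metis card_eq_0_iff of_nat_eq_0_iff peval_0 power_not_zero)
qed

lemma Qcone_lower_bound:
  assumes "simple_graph G" "graph_matrix G t \<in> Qcone (verts G) r" "stable G S" "S \<noteq> {}"
  shows "real (card S) \<le> t"
  using assms stable_lower_bound [of G "(\<Sum>i\<in>verts G. var i) ^ r" t r S]
    sum_var_power_neq_0 [of "verts G" r]
  by (auto simp: Qcone_def simple_graph_def stable_def)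

section \<open>The minimum is attained\<close>

lemma compact_Pi_UNIV:
  fixes K :: "'i \<Rightarrow> 'b::topological_space set"
  assumes "\<And>i. compact (K i)"
  shows "compact (Pi UNIV K)"
proof -
  have "compactin (product_topology (\<lambda>_. euclidean) UNIV) (Pi\<^sub>E UNIV K)"
    using assms by (simp add: compactin_PiE)
  then show ?thesis by (simp add: euclidean_product_topology PiE_UNIV_domain Pi_def)
qed

text \<open>
  By the parallelogram law, a bound for the form at \<open>1\<close> and \<open>1 + e\<^sub>i\<close> bounds the diagonal entry at
  \<open>i\<close>, and positive semidefiniteness bounds the others.
\<close>

lemma psd_entry_bound:
  assumes fin: "finite X" and psd: "psd X B" and i: "i \<in> X" and j: "j \<in> X"
    and D: "qval X B (\<lambda>_. 1) \<le> D"
      "\<And>k. k \<in> X \<Longrightarrow> qval X B (\<lambda>l. 1 + (if l = k then 1 else 0)) \<le> D"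
  shows "\<bar>B i j\<bar> \<le> 4 * D"
proof -
  have sym: "symmetric_on X B" using psd by (simp add: psd_def)
  define e where "e k = (\<lambda>l. if l = k then 1 else (0::real))" for k :: 'a
  have ebval: "bval X B (e k) (e l) = B k l" if "k \<in> X" "l \<in> X" for k l
    using bval_unit_left [OF fin that(1), of B "e l"] that(2) fin
    by (simp add: e_def if_distrib cong: if_cong)
  have diag: "B k k \<le> 4 * D" if k: "k \<in> X" for k
  proof -
    let ?b = "bval X B (\<lambda>_. 1) (e k)"
    have p: "qval X B (\<lambda>l. 1 + e k l) = qval X B (\<lambda>_. 1) + 2 * ?b + B k k"
      unfolding qval_add [OF sym] ebval [OF k k] ..
    have "0 \<le> qval X B (\<lambda>l. 2 * 1 + 1 * e k l)" by (rule psd_nonneg [OF psd])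
    also have "\<dots> = 4 * qval X B (\<lambda>_. 1) + 4 * ?b + B k k"
      unfolding qval_add [OF sym] bval_scale_left bval_scale_right ebval [OF k k] by simp
    finally have q: "0 \<le> 4 * qval X B (\<lambda>_. 1) + 4 * ?b + B k k" .
    have "qval X B (\<lambda>l. 1 + e k l) \<le> D" using D(2) [OF k] by (simp add: e_def)
    then show ?thesis using p q D(1) psd_nonneg [OF psd, of "\<lambda>_. 1"] by linarith
  qed
  have "0 \<le> B i i + 2 * s * B i j + s * s * B j j" for s
  proof -
    have "0 \<le> qval X B (\<lambda>l. e i l + s * e j l)" by (rule psd_nonneg [OF psd])
    also have "\<dots> = B i i + 2 * s * B i j + s * s * B j j"
      unfolding qval_add [OF sym] bval_scale_left bval_scale_right ebval [OF i i] ebval [OF j j] ebval [OF i j]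
      by simp
    finally show ?thesis .
  qed
  from this [of 1] this [of "-1"] show ?thesis using diag [OF i] diag [OF j] by auto
qed

lemma lookup_cert:
  "lookup (cert X r B c) \<gamma> =
    (\<Sum>\<beta>\<in>mons X r. \<Sum>i\<in>X. \<Sum>j\<in>X. B \<beta> i j * lookup (mono_power \<beta> * var i * var j) \<gamma>) +
    (\<Sum>\<gamma>'\<in>mons X (r + 2). c \<gamma>' * lookup (mono_power \<gamma>') \<gamma>)"
proof -
  have "mono_power \<beta> * quad_form X (B \<beta>) = (\<Sum>i\<in>X. \<Sum>j\<in>X. const (B \<beta> i j) * (mono_power \<beta> * var i * var j))" for \<beta>
    by (simp add: quad_form_def sum_distrib_left mult_ac)
  moreover have "mono_power \<gamma>' * const (c \<gamma>') = const (c \<gamma>') * mono_power \<gamma>'" for \<gamma>'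
    by (rule mult.commute)
  ultimately show ?thesis
    by (simp only: cert_def lookup_add lookup_sum lookup_const_mult)
qed

lemma lookup_graph_target:
  "lookup (p * quad_form X (graph_matrix G t)) \<gamma> =
    t * lookup (p * quad_form X (closed_adj G)) \<gamma> - lookup (p * (\<Sum>i\<in>X. var i)\<^sup>2) \<gamma>"
proof -
  have "p * quad_form X (graph_matrix G t) =
      const t * (p * quad_form X (closed_adj G)) - p * (\<Sum>i\<in>X. var i)\<^sup>2"
    by (simp add: quad_form_graph_matrix right_diff_distrib mult.left_commute)
  then show ?thesis by (simp add: lookup_minus lookup_const_mult)
qed

text \<open>
  For \<open>n\<close> vertices, \<open>n(A + I) - J\<close> is the positive semidefinite matrix \<open>nI - J\<close> plus a nonnegative one.
\<close>

lemma Qcone_nonempty: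
  assumes "simple_graph G"
  shows "graph_matrix G (card (verts G)) \<in> Qcone (verts G) r"
proof -
  let ?X = "verts G" and ?n = "real (card (verts G))"
  have fin: "finite ?X" using assms by (simp add: simple_graph_def)
  let ?p = "(\<Sum>i\<in>?X. var i) ^ r"
  let ?D = "\<lambda>i j. ?n * (if id i = id j then 1 else 0) - 1"
  have nn: "nonneg_coeffs (quad_form ?X (\<lambda>i j. ?n * adjacency G i j))"
    unfolding quad_form_def
    by (intro nonneg_coeffs_sum nonneg_coeffs_mult nonneg_coeffs_const nonneg_coeffs_var)
      (simp add: adjacency_def)
  have "?p * quad_form ?X ?D \<in> Hcone ?X r"
    using psd_partition [OF fin fin, of id] fin
    by (intro Hcone_mult_psd sum_var_power_polys homogeneous_sum_var_power nonneg_coeffs_sum_var_power) auto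
  moreover have "?p * quad_form ?X (\<lambda>i j. ?n * adjacency G i j) \<in> Hcone ?X r"
    using fin nn
    by (intro Hcone_nonneg polys_mult sum_var_power_polys quad_form_polys
        homogeneous_mult homogeneous_sum_var_power homogeneous_quad_form
        nonneg_coeffs_mult nonneg_coeffs_sum_var_power)
  moreover have "quad_form ?X (graph_matrix G ?n) = quad_form ?X ?D + quad_form ?X (\<lambda>i j. ?n * adjacency G i j)"
    unfolding quad_form_add [symmetric]
    by (rule quad_form_cong) (simp add: graph_matrix_def algebra_simps)
  ultimately show ?thesis
    using Hcone_add [OF fin] symmetric_graph_matrix
    by (simp add: Qcone_def distrib_left)
qed

text \<open>
  The admissible \<open>t\<close> together with their certificates form a compact set: every term of a
  certificate is nonnegative on the nonnegative orthant, hence at most the value of the polynomial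
  there, and finitely many such values bound the entries of the matrices.
\<close>

theorem nu_attained:
  assumes G: "simple_graph G" and ne: "verts G \<noteq> {}"
  shows "graph_matrix G (nu r G) \<in> Qcone (verts G) r"
    and "graph_matrix G t \<in> Qcone (verts G) r \<Longrightarrow> nu r G \<le> t"
proof -
  let ?X = "verts G"
  define P where "P t \<longleftrightarrow> graph_matrix G t \<in> Qcone ?X r" for t
  have fin: "finite ?X" using G by (simp add: simple_graph_def)
  define Y where "Y = (\<Sum>i\<in>?X. var i) ^ r"
  define F where "F t = Y * quad_form ?X (graph_matrix G t)" for t
  have P_iff: "P t \<longleftrightarrow> (\<exists>B c. valid_cert ?X r B c \<and> F t = cert ?X r B c)" for t
    unfolding P_def Qcone_def F_def Y_def using symmetric_graph_matrix Hcone_iff_cert [OF fin] by blast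
  define n where "n = real (card ?X)"
  have Pn: "P n" unfolding P_def n_def by (rule Qcone_nonempty [OF G])
  have t_nonneg: "0 \<le> t" if "P t" for t
  proof -
    obtain a where "a \<in> ?X" using ne by blast
    moreover have "{a, a} \<notin> edges G" using G by (auto simp: simple_graph_def)
    ultimately have "stable G {a}" by (simp add: stable_def)
    then show ?thesis using Qcone_lower_bound [OF G, of t r "{a}"] that by (simp add: P_def)
  qed
  \<comment> \<open>The points at which \<open>psd_entry_bound\<close> needs values; all their coordinates are at least 1, so every
    monomial is at least 1 there and can be dropped from the terms of a certificate.\<close>
  define ones where "ones = (\<lambda>_::'a. 1::real)"
  define x where "x k = (\<lambda>l. 1 + (if l = k then 1 else (0::real)))" for k :: 'a
  define D where "D = (\<Sum>y\<in>insert ones (x ` ?X). \<bar>peval y (F n)\<bar>)"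
  have D0: "0 \<le> D" unfolding D_def by (intro sum_nonneg) simp
  have term_le: "qval ?X (B \<beta>) y \<le> D" "c \<gamma> \<le> D"
    if v: "valid_cert ?X r B c" and eq: "F t = cert ?X r B c" and t: "t \<le> n"
      and \<beta>: "\<beta> \<in> mons ?X r" and \<gamma>: "\<gamma> \<in> mons ?X (r + 2)" and y: "y \<in> insert ones (x ` ?X)" for t B c \<beta> \<gamma> y
  proof -
    have y1: "1 \<le> y i" for i using y by (auto simp: ones_def x_def)
    then have y0: "0 \<le> y i" for i by (rule order_trans [OF zero_le_one])
    have m1: "1 \<le> mval y \<delta>" for \<delta> using y1 by (intro mval_ge_1)
    then have m0: "0 \<le> mval y \<delta>" for \<delta> by (rule order_trans [OF zero_le_one])
    have B0: "0 \<le> mval y \<beta> * qval ?X (B \<beta>) y" if "\<beta> \<in> mons ?X r" for \<beta>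
      using v that m0 by (intro mult_nonneg_nonneg psd_nonneg) (auto simp: valid_cert_def)
    have c0: "0 \<le> mval y \<gamma> * c \<gamma>" if "\<gamma> \<in> mons ?X (r + 2)" for \<gamma>
      using v that m0 by (intro mult_nonneg_nonneg) (auto simp: valid_cert_def)
    have S: "0 \<le> (\<Sum>\<beta>\<in>mons ?X r. mval y \<beta> * qval ?X (B \<beta>) y)" "0 \<le> (\<Sum>\<gamma>\<in>mons ?X (r + 2). mval y \<gamma> * c \<gamma>)"
      using B0 c0 by (intro sum_nonneg; blast)+
    have "peval y (F t) \<le> peval y (F n)"
    proof -
      have "0 \<le> peval y Y" using y0 by (simp add: Y_def peval_power peval_sum sum_nonneg)
      moreover have "0 \<le> qval ?X (closed_adj G) y"
        unfolding bval_def using y0 closed_adj_nonneg by (intro sum_nonneg mult_nonneg_nonneg) auto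
      ultimately show ?thesis
        unfolding F_def peval_mult peval_quad_form qval_graph_matrix
        using t by (intro mult_left_mono diff_right_mono mult_right_mono)
    qed
    also have "peval y (F n) \<le> \<bar>peval y (F n)\<bar>" by simp
    also have "\<dots> \<le> D" unfolding D_def using fin y by (intro member_le_sum [where f = "\<lambda>y. \<bar>peval y (F n)\<bar>"]) auto
    finally have FD: "(\<Sum>\<beta>\<in>mons ?X r. mval y \<beta> * qval ?X (B \<beta>) y) + (\<Sum>\<gamma>\<in>mons ?X (r + 2). mval y \<gamma> * c \<gamma>) \<le> D"
      unfolding eq peval_cert .
    have "qval ?X (B \<beta>) y \<le> mval y \<beta> * qval ?X (B \<beta>) y"
      using mult_right_mono [OF m1, of "qval ?X (B \<beta>) y" \<beta>] v \<beta> by (auto simp: valid_cert_def psd_nonneg)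
    also have "\<dots> \<le> (\<Sum>\<beta>\<in>mons ?X r. mval y \<beta> * qval ?X (B \<beta>) y)"
      using B0 \<beta> finite_mons [OF fin] by (intro member_le_sum [where f = "\<lambda>\<beta>. mval y \<beta> * qval ?X (B \<beta>) y"]) auto
    finally show "qval ?X (B \<beta>) y \<le> D" using FD S by linarith
    have "c \<gamma> \<le> mval y \<gamma> * c \<gamma>"
      using mult_right_mono [OF m1, of "c \<gamma>" \<gamma>] v \<gamma> by (auto simp: valid_cert_def)
    also have "\<dots> \<le> (\<Sum>\<gamma>\<in>mons ?X (r + 2). mval y \<gamma> * c \<gamma>)"
      using c0 \<gamma> finite_mons [OF fin] by (intro member_le_sum [where f = "\<lambda>\<gamma>. mval y \<gamma> * c \<gamma>"]) auto
    finally show "c \<gamma> \<le> D" using FD S by linarith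
  qed
  have mons_ne: "mons ?X d \<noteq> {}" for d
  proof -
    obtain a where "a \<in> ?X" using ne by blast
    then have "single a d \<in> mons ?X d" by (auto simp: mons_def exps_def)
    then show ?thesis by blast
  qed
  \<comment> \<open>Entries at indices that do not occur in a certificate are set to 0, so that all of them lie in
    a product of compact intervals.\<close>
  define box1 where "box1 = Pi UNIV (\<lambda>\<beta>::'a expvec. Pi UNIV (\<lambda>i::'a. Pi UNIV (\<lambda>j::'a. {- (4 * D)..4 * D})))"
  define box2 where "box2 = Pi UNIV (\<lambda>\<gamma>::'a expvec. {0..D})"
  define K where "K = ({0..n} \<times> box1 \<times> box2) \<inter>
    {(t, B, c). valid_cert ?X r B c \<and> (\<forall>\<gamma>. lookup (F t) \<gamma> = lookup (cert ?X r B c) \<gamma>)}"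
  have "closed {g. valid_cert ?X r (fst (snd g)) (snd (snd g)) \<and>
      (\<forall>\<gamma>. lookup (F (fst g)) \<gamma> = lookup (cert ?X r (fst (snd g)) (snd (snd g))) \<gamma>)}"
  proof -
    have "continuous_on UNIV (\<lambda>g :: real \<times> ('a expvec \<Rightarrow> 'a \<Rightarrow> 'a \<Rightarrow> real) \<times> ('a expvec \<Rightarrow> real). fst (snd g))"
      and "continuous_on UNIV (\<lambda>g :: real \<times> ('a expvec \<Rightarrow> 'a \<Rightarrow> 'a \<Rightarrow> real) \<times> ('a expvec \<Rightarrow> real). snd (snd g))"
      by (intro continuous_intros)+
    note c = this [THEN continuous_on_product_then_coordinatewise]
    note cB = c(1) [THEN continuous_on_product_then_coordinatewise, THEN continuous_on_product_then_coordinatewise]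
    show ?thesis
      unfolding valid_cert_def psd_def symmetric_on_def bval_def Ball_def lookup_cert F_def lookup_graph_target
      by (intro closed_Collect_conj closed_Collect_all closed_Collect_imp closed_Collect_le closed_Collect_eq
          open_Collect_const cB c(2) continuous_on_add continuous_on_diff
          continuous_on_mult continuous_on_sum continuous_on_const continuous_on_fst continuous_on_id)
  qed
  then have "closed {(t, B, c). valid_cert ?X r B c \<and> (\<forall>\<gamma>. lookup (F t) \<gamma> = lookup (cert ?X r B c) \<gamma>)}"
    by (simp add: case_prod_unfold)
  moreover have "compact ({0..n} \<times> box1 \<times> box2)"
    unfolding box1_def box2_def by (intro compact_Times compact_Pi_UNIV compact_Icc)
  ultimately have compact: "compact K"
    unfolding K_def by (intro compact_Int_closed)
  have in_K: "\<exists>B c. (t, B, c) \<in> K" if Pt: "P t" and t: "t \<le> n" for t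
  proof -
    obtain B c where v: "valid_cert ?X r B c" and eq: "F t = cert ?X r B c" using Pt P_iff by blast
    define B' where "B' \<beta> i j = (if \<beta> \<in> mons ?X r \<and> i \<in> ?X \<and> j \<in> ?X then B \<beta> i j else 0)" for \<beta> i j
    define c' where "c' \<gamma> = (if \<gamma> \<in> mons ?X (r + 2) then c \<gamma> else 0)" for \<gamma>
    have "valid_cert ?X r B' c'"
      using v by (simp add: valid_cert_def psd_def symmetric_on_def bval_def B'_def c'_def)
    moreover have "cert ?X r B' c' = F t"
      unfolding eq cert_def by (simp add: B'_def c'_def quad_form_def)
    moreover have "\<bar>B' \<beta> i j\<bar> \<le> 4 * D" for \<beta> i j
    proof (cases "\<beta> \<in> mons ?X r \<and> i \<in> ?X \<and> j \<in> ?X")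
      case True
      then have "\<bar>B \<beta> i j\<bar> \<le> 4 * D"
        using v term_le(1) [OF v eq t, of \<beta>] mons_ne [of "r + 2"]
        by (intro psd_entry_bound [OF fin, of "B \<beta>"]) (auto simp: valid_cert_def ones_def x_def)
      then show ?thesis using True by (simp add: B'_def)
    qed (use D0 in \<open>auto simp: B'_def\<close>)
    moreover have "0 \<le> c' \<gamma> \<and> c' \<gamma> \<le> D" for \<gamma>
      using v term_le(2) [OF v eq t _ _ insertI1, of _ \<gamma>] mons_ne [of r] D0
      by (auto simp: c'_def valid_cert_def)
    ultimately have "(t, B', c') \<in> K"
      using t t_nonneg [OF Pt] by (auto simp: K_def box1_def box2_def abs_le_iff minus_le_iff)
    then show ?thesis by blast
  qed
  have "K \<noteq> {}" using in_K [OF Pn] by auto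
  then obtain g where g: "g \<in> K" "\<And>h. h \<in> K \<Longrightarrow> fst g \<le> fst h"
    using continuous_attains_inf [OF compact, of fst] continuous_on_fst [OF continuous_on_id, of K] by auto
  obtain s B c where g_eq: "g = (s, B, c)" by (cases g)
  have "valid_cert ?X r B c" "F s = cert ?X r B c"
    using g(1) unfolding g_eq K_def by (auto intro: poly_mapping_eqI)
  then have "P (fst g)" unfolding P_iff g_eq by auto
  moreover have "fst g \<le> u" if "P u" for u
  proof (cases "u \<le> n")
    case True
    then show ?thesis using in_K [OF that True] g(2) by force
  next
    case False
    then show ?thesis using in_K [OF Pn] g(2) by force
  qed
  ultimately have "P (LEAST t. P t) \<and> (\<forall>u. P u \<longrightarrow> (LEAST t. P t) \<le> u)"
    by (metis Least_equality)
  then show "graph_matrix G (nu r G) \<in> Qcone (verts G) r"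
    and "graph_matrix G t \<in> Qcone (verts G) r \<Longrightarrow> nu r G \<le> t"
    unfolding nu_def P_def by blast+
qed

lemma nu_gt_stability_number:
  assumes G: "simple_graph G" and ne: "verts G \<noteq> {}"
    and n: "graph_matrix G (stability_number G) \<notin> Qcone (verts G) r"
  shows "real (stability_number G) < nu r G"
proof -
  obtain S where S: "stable G S" "card S = stability_number G"
    using stability_number_attained [OF G] .
  obtain a where "a \<in> verts G" using ne by blast
  moreover have "{a, a} \<notin> edges G" using G by (auto simp: simple_graph_def)
  ultimately have "stable G {a}" by (simp add: stable_def)
  then have "S \<noteq> {}" using card_stable_le [OF G, of "{a}"] S by auto
  then have "real (stability_number G) \<le> nu r G"
    using Qcone_lower_bound [OF G nu_attained(1) [OF G ne] S(1), of r] S(2) by simp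
  moreover have "nu r G \<noteq> real (stability_number G)"
    using nu_attained(1) [OF G ne, of r] n by auto
  ultimately show ?thesis by simp
qed

section \<open>An obstruction from critical pairs\<close>

definition max_stable :: "'a graph \<Rightarrow> 'a set \<Rightarrow> bool" where
  "max_stable G S \<longleftrightarrow> stable G S \<and> card S = stability_number G"

text \<open>
  Two distinct vertices of such a pair are adjacent, and their edge is critical: deleting it makes
  \<open>C \<union> {a, b}\<close> stable and so raises the stability number.
\<close>

definition critical_pairs :: "'a graph \<Rightarrow> 'a set \<Rightarrow> ('a \<times> 'a) set" where
  "critical_pairs G R = {(a, b). \<exists>C. R \<subseteq> C \<and> a \<notin> C \<and> b \<notin> C \<and>
     max_stable G (insert a C) \<and> max_stable G (insert b C)}"

text \<open>
  The form of the graph vanishes at a maximum stable set, hence so does every term of a certificate.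
\<close>

lemma cert_zero:
  assumes G: "simple_graph G"
    and v: "valid_cert (verts G) r B c"
    and eq: "p * quad_form (verts G) (graph_matrix G (stability_number G)) = cert (verts G) r B c"
    and S: "max_stable G S" and \<beta>: "\<beta> \<in> mons (verts G) r" "keys \<beta> \<subseteq> S"
  shows "qval (verts G) (B \<beta>) (ind S) = 0"
proof -
  let ?X = "verts G"
  have fin: "finite ?X" using G by (simp add: simple_graph_def)
  have st: "stable G S" "card S = stability_number G" using S by (auto simp: max_stable_def)
  have nn: "0 \<le> mval (ind S) \<delta>" for \<delta> by (intro mval_nonneg) (simp add: ind_def)
  have B0: "0 \<le> mval (ind S) \<beta> * qval ?X (B \<beta>) (ind S)" if "\<beta> \<in> mons ?X r" for \<beta>
    using v that nn by (intro mult_nonneg_nonneg psd_nonneg) (auto simp: valid_cert_def)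
  have c0: "0 \<le> mval (ind S) \<gamma> * c \<gamma>" if "\<gamma> \<in> mons ?X (r + 2)" for \<gamma>
    using v that nn by (intro mult_nonneg_nonneg) (auto simp: valid_cert_def)
  have "peval (ind S) (p * quad_form ?X (graph_matrix G (stability_number G))) = 0"
    by (simp add: peval_mult qval_graph_matrix qval_stable [OF G st(1)] st(2) power2_eq_square)
  then have "(\<Sum>\<beta>\<in>mons ?X r. mval (ind S) \<beta> * qval ?X (B \<beta>) (ind S)) + (\<Sum>\<gamma>\<in>mons ?X (r + 2). mval (ind S) \<gamma> * c \<gamma>) = 0"
    unfolding eq peval_cert .
  moreover have "0 \<le> (\<Sum>\<beta>\<in>mons ?X r. mval (ind S) \<beta> * qval ?X (B \<beta>) (ind S))" "0 \<le> (\<Sum>\<gamma>\<in>mons ?X (r + 2). mval (ind S) \<gamma> * c \<gamma>)"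
    using B0 c0 by (intro sum_nonneg; blast)+
  ultimately have "(\<Sum>\<beta>\<in>mons ?X r. mval (ind S) \<beta> * qval ?X (B \<beta>) (ind S)) = 0"
    by linarith
  then have "mval (ind S) \<beta> * qval ?X (B \<beta>) (ind S) = 0"
    using sum_nonneg_eq_0_iff [OF finite_mons [OF fin], of r "\<lambda>\<beta>. mval (ind S) \<beta> * qval ?X (B \<beta>) (ind S)"] B0 \<beta>(1) by blast
  moreover have "1 \<le> mval (ind S) \<beta>" using \<beta>(2) by (intro mval_ge_1) (auto simp: ind_def)
  ultimately show ?thesis by auto
qed

lemma critical_pairs_entries:
  assumes G: "simple_graph G" and psd: "psd (verts G) B"
    and zero: "\<And>S. max_stable G S \<Longrightarrow> R \<subseteq> S \<Longrightarrow> qval (verts G) B (ind S) = 0"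
    and link: "(a, b) \<in> (critical_pairs G R)\<^sup>*" and y: "y \<in> verts G"
  shows "B y a = B y b"
  using link
proof (induction rule: rtrancl_induct)
  case (step b d)
  have fin: "finite (verts G)" using G by (simp add: simple_graph_def)
  have sum0: "(\<Sum>j\<in>S. B y j) = 0" if "max_stable G S" "R \<subseteq> S" for S
  proof -
    have "(\<Sum>j\<in>verts G. ind S j * B y j) = 0"
      using psd_kernel [OF fin psd zero [OF that] y] by (simp add: mult.commute)
    then show ?thesis using sum_ind [OF fin, of S] that(1) by (simp add: max_stable_def stable_def)
  qed
  obtain C where C: "R \<subseteq> C" "b \<notin> C" "d \<notin> C" "max_stable G (insert b C)" "max_stable G (insert d C)"
    using step.hyps(2) by (auto simp: critical_pairs_def)
  have "finite C" using C(4) stable_finite [OF G, of "insert b C"] by (simp add: max_stable_def)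
  then have "B y b = B y d"
    using sum0 [OF C(4)] sum0 [OF C(5)] C(1-3) by (simp add: subset_insertI2)
  then show ?case using step.IH by simp
qed simp

lemma lookup_sum_unit: "finite I \<Longrightarrow> lookup (\<Sum>i\<in>I. unit_exp i) l = (if l \<in> I then 1 else 0)"
  by (simp add: lookup_sum lookup_single when_def)

lemma unit_exp_eq_iff: "unit_exp i = unit_exp j \<longleftrightarrow> i = j"
  by (metis lookup_single_eq lookup_single_not_eq zero_neq_one)

lemma lookup_sum_var_power_pos:
  assumes "finite X" "finite I" "I \<subseteq> X"
  shows "0 < lookup ((\<Sum>i\<in>X. var i) ^ card I) (\<Sum>i\<in>I. unit_exp i)"
  using assms(2,3)
proof (induction I rule: finite_induct)
  case (insert a I)
  have "lookup (\<Sum>i\<in>X. var i) (unit_exp a) = (\<Sum>i\<in>X. if i = a then 1 else 0)"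
    unfolding lookup_sum var_eq lookup_single when_def unit_exp_eq_iff ..
  then have "0 < lookup (\<Sum>i\<in>X. var i) (unit_exp a)" using insert.prems assms(1) by simp
  moreover have "0 < lookup ((\<Sum>i\<in>X. var i) ^ card I) (\<Sum>i\<in>I. unit_exp i)" using insert by blast
  ultimately have "0 < lookup ((\<Sum>i\<in>X. var i) * (\<Sum>i\<in>X. var i) ^ card I) (unit_exp a + (\<Sum>i\<in>I. unit_exp i))"
    by (intro lookup_mult_pos nonneg_coeffs_power nonneg_coeffs_sum nonneg_coeffs_var)
  then show ?case using insert.hyps by simp
qed simp

lemma lookup_mult_var_var:
  assumes "lookup (p * var i * var j) \<gamma> \<noteq> 0"
  obtains \<delta> where "\<gamma> = \<delta> + unit_exp i + unit_exp j"
proof -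
  have "\<gamma> \<in> keys (p * var i * var j)" using assms by (simp add: in_keys_iff)
  then obtain \<epsilon> where "\<epsilon> \<in> keys (p * var i)" "\<gamma> = \<epsilon> + unit_exp j"
    using keys_mult [of "p * var i" "var j"] by (auto simp: var_eq)
  moreover then obtain \<delta> where "\<epsilon> = \<delta> + unit_exp i"
    using keys_mult [of p "var i"] by (auto simp: var_eq)
  ultimately show thesis using that by simp
qed

text \<open>
  The coefficient at the squarefree monomial of \<open>I\<close> is negative in the polynomial, because no edge
  joins vertices of \<open>I\<close>. In a certificate, apart from a nonnegative constant, only the entries of the
  Gram matrices at two distinct vertices \<open>i\<close>, \<open>j\<close> of \<open>I\<close> contribute to it, where the matrix belongs to
  the monomial of \<open>I - {i, j}\<close>. That matrix annihilates the indicator vectors of all maximum stable sets that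
  contain \<open>I - {i, j}\<close>, so its columns at a critical pair agree and the entry equals a diagonal one.
\<close>

theorem critical_pairs_obstruction:
  assumes G: "simple_graph G" and I: "stable G I" "card I = r + 2"
    and link: "\<And>i j. i \<in> I \<Longrightarrow> j \<in> I \<Longrightarrow> i \<noteq> j \<Longrightarrow> (i, j) \<in> (critical_pairs G (I - {i, j}))\<^sup>*"
  shows "graph_matrix G (stability_number G) \<notin> Qcone (verts G) r"
proof
  assume Q: "graph_matrix G (stability_number G) \<in> Qcone (verts G) r"
  let ?X = "verts G" and ?\<alpha> = "real (stability_number G)"
  let ?p = "(\<Sum>i\<in>?X. var i) ^ r"
  have fin: "finite ?X" and IX: "I \<subseteq> ?X" using G I by (auto simp: simple_graph_def stable_def)
  have finI: "finite I" using stable_finite [OF G I(1)] .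
  obtain B c where v: "valid_cert ?X r B c" and eq: "?p * quad_form ?X (graph_matrix G ?\<alpha>) = cert ?X r B c"
    using Q by (auto simp: Qcone_def Hcone_iff_cert [OF fin])
  define \<gamma> where "\<gamma> = (\<Sum>i\<in>I. unit_exp i)"
  have lk: "lookup \<gamma> l = (if l \<in> I then 1 else 0)" for l
    unfolding \<gamma>_def using lookup_sum_unit [OF finI] .
  have split: "i \<in> I \<and> j \<in> I \<and> i \<noteq> j \<and> keys \<delta> \<subseteq> I - {i, j}" if g: "\<gamma> = \<delta> + unit_exp i + unit_exp j" for \<delta> i j
  proof -
    have l: "lookup \<delta> l + (if i = l then 1 else 0) + (if j = l then 1 else 0) = (if l \<in> I then 1 else 0)" for l
      unfolding lk [symmetric] g by (simp add: lookup_add lookup_single when_def)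
    have "i \<in> I" using l [of i] by (auto split: if_splits)
    moreover have "j \<in> I" using l [of j] by (auto split: if_splits)
    moreover have "i \<noteq> j" using l [of i] by (auto split: if_splits)
    moreover have "l \<in> I - {i, j}" if "l \<in> keys \<delta>" for l
      using l [of l] that by (auto simp: in_keys_iff split: if_splits)
    ultimately show ?thesis by blast
  qed
  have "lookup (?p * quad_form ?X (closed_adj G)) \<gamma> = 0"
  proof -
    have "closed_adj G i j * lookup (?p * var i * var j) \<gamma> = 0" for i j
    proof (cases "lookup (?p * var i * var j) \<gamma> = 0")
      case False
      then obtain \<delta> where "\<gamma> = \<delta> + unit_exp i + unit_exp j" by (rule lookup_mult_var_var)
      then have "i \<in> I \<and> j \<in> I \<and> i \<noteq> j" using split by blast
      then show ?thesis using stable_closed_adj [OF I(1), of i j] by simp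
    qed simp
    moreover have "?p * quad_form ?X (closed_adj G) = (\<Sum>i\<in>?X. \<Sum>j\<in>?X. const (closed_adj G i j) * (?p * var i * var j))"
      by (simp add: quad_form_def sum_distrib_left mult_ac)
    ultimately show ?thesis by (simp only: lookup_sum lookup_const_mult sum.neutral_const)
  qed
  moreover have "0 < lookup (?p * (\<Sum>i\<in>?X. var i)\<^sup>2) \<gamma>"
    using lookup_sum_var_power_pos [OF fin finI IX] by (simp only: I(2) \<gamma>_def power_add)
  ultimately have neg: "lookup (?p * quad_form ?X (graph_matrix G ?\<alpha>)) \<gamma> < 0"
    by (simp add: lookup_graph_target)
  have "0 \<le> B \<beta> i j * lookup (mono_power \<beta> * var i * var j) \<gamma>" if \<beta>: "\<beta> \<in> mons ?X r" for \<beta> i j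
  proof -
    have e: "mono_power \<beta> * var i * var j = single (\<beta> + unit_exp i + unit_exp j) 1"
      by (simp add: mono_power_eq_single var_eq mult_single)
    show ?thesis
    proof (cases "\<gamma> = \<beta> + unit_exp i + unit_exp j")
      case True
      have ij: "i \<in> I" "j \<in> I" "i \<noteq> j" "keys \<beta> \<subseteq> I - {i, j}" using split [OF True] by auto
      have psd: "psd ?X (B \<beta>)" using v \<beta> by (simp add: valid_cert_def)
      have "B \<beta> i i = B \<beta> i j"
      proof (rule critical_pairs_entries [OF G psd _ link [OF ij(1-3)]])
        show "qval ?X (B \<beta>) (ind S) = 0" if "max_stable G S" "I - {i, j} \<subseteq> S" for S
          using cert_zero [OF G v eq that(1) \<beta>] that(2) ij(4) by blast
        show "i \<in> ?X" using ij(1) IX by blast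
      qed
      moreover have "0 \<le> B \<beta> i i"
        using psd_nonneg [OF psd, of "\<lambda>l. if l = i then 1 else 0"] qval_unit [OF fin, of i "B \<beta>"] ij(1) IX by auto
      ultimately show ?thesis by (simp add: e lookup_single when_def)
    qed (simp add: e lookup_single when_def)
  qed
  moreover have "0 \<le> c \<gamma>' * lookup (mono_power \<gamma>') \<gamma>" if "\<gamma>' \<in> mons ?X (r + 2)" for \<gamma>'
    using v that by (simp add: valid_cert_def mono_power_eq_single lookup_single when_def)
  ultimately have "0 \<le> lookup (cert ?X r B c) \<gamma>"
    unfolding lookup_cert by (intro add_nonneg_nonneg sum_nonneg) auto
  then show False using neg eq by simp
qed

section \<open>Certificates with a linear multiplier\<close>

lemma closed_adj_cases: "simple_graph G \<Longrightarrow> closed_adj G i j = 0 \<or> closed_adj G i j = 1"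
  by (auto simp: closed_adj_def adjacency_def simple_graph_def)

lemma closed_adj_commute: "closed_adj G i j = closed_adj G j i"
  by (auto simp: closed_adj_def adjacency_def insert_commute)

lemma mval_1: "mval (\<lambda>_. 1) \<beta> = 1"
  by (simp add: mval_def)

lemma norm1_eq_peval: "nonneg_coeffs p \<Longrightarrow> norm1 p = peval (\<lambda>_. 1) p"
  by (simp add: norm1_def peval_def mval_1 nonneg_coeffs_def)

text \<open>
  The coefficient of a monomial is a sum over all triples of variables with that product, so the
  three summands in the hypothesis can be averaged.
\<close>

lemma nonneg_coeffs_cubic:
  assumes "\<And>s a b. s \<in> X \<Longrightarrow> a \<in> X \<Longrightarrow> b \<in> X \<Longrightarrow> 0 \<le> E s a b + E a s b + E b s a"
  shows "nonneg_coeffs (\<Sum>s\<in>X. var s * quad_form X (E s))"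
proof -
  define t where "t s a b = const (E s a b) * (var s * var a * var b)" for s a b
  define R where "R = (\<Sum>s\<in>X. var s * quad_form X (E s))"
  have 0: "R = (\<Sum>s\<in>X. \<Sum>a\<in>X. \<Sum>b\<in>X. t s a b)"
    unfolding R_def quad_form_def t_def by (simp add: sum_distrib_left mult_ac)
  then have 1: "R = (\<Sum>s\<in>X. \<Sum>a\<in>X. \<Sum>b\<in>X. t a s b)"
    by (subst sum.swap)
  have "(\<Sum>s\<in>X. \<Sum>a\<in>X. \<Sum>b\<in>X. t b s a) = (\<Sum>s\<in>X. \<Sum>b\<in>X. \<Sum>a\<in>X. t b s a)"
    by (intro sum.cong refl sum.swap)
  also have "\<dots> = (\<Sum>b\<in>X. \<Sum>s\<in>X. \<Sum>a\<in>X. t b s a)" by (rule sum.swap)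
  finally have 2: "R = (\<Sum>s\<in>X. \<Sum>a\<in>X. \<Sum>b\<in>X. t b s a)" using 0 by simp
  have "R + R + R = (\<Sum>s\<in>X. \<Sum>a\<in>X. \<Sum>b\<in>X. t s a b + t a s b + t b s a)"
    by (subst (1) 0, subst (1) 1, subst (1) 2) (simp add: sum.distrib)
  also have "\<dots> = (\<Sum>s\<in>X. \<Sum>a\<in>X. \<Sum>b\<in>X. const (E s a b + E a s b + E b s a) * (var s * var a * var b))"
    by (simp add: t_def const_add algebra_simps)
  also have "nonneg_coeffs \<dots>"
    using assms by (intro nonneg_coeffs_sum nonneg_coeffs_mult nonneg_coeffs_const nonneg_coeffs_var)
  finally have "0 \<le> lookup R \<beta> + lookup R \<beta> + lookup R \<beta>" for \<beta>
    unfolding nonneg_coeffs_def lookup_add by blast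
  then have "0 \<le> lookup R \<beta>" for \<beta> by (smt (verit))
  then show ?thesis unfolding R_def [symmetric] nonneg_coeffs_def by simp
qed

text \<open>
  The function \<open>f s\<close> numbers the classes into which the vertices are split for \<open>s \<in> T\<close>: class 0 is the
  closed neighbourhood of \<open>s\<close>, and the other classes are cliques. For stable sets the existence of such a
  partition implies that a stable set containing \<open>s\<close> has at most \<open>m\<close> elements.
\<close>

theorem clique_partitions_Qcone_tilde:
  fixes f :: "'a \<Rightarrow> 'a \<Rightarrow> nat"
  assumes G: "simple_graph G" and T: "T \<subseteq> verts G" "T \<noteq> {}"
    and range: "\<And>s a. s \<in> T \<Longrightarrow> a \<in> verts G \<Longrightarrow> f s a < m"
    and nbhd: "\<And>s a. s \<in> T \<Longrightarrow> a \<in> verts G \<Longrightarrow> f s a = 0 \<longleftrightarrow> closed_adj G s a = 1"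
    and clique: "\<And>s a b. s \<in> T \<Longrightarrow> a \<in> verts G \<Longrightarrow> b \<in> verts G \<Longrightarrow> f s a = f s b \<Longrightarrow> f s a \<noteq> 0 \<Longrightarrow>
      closed_adj G a b = 1"
    and cover: "\<And>s a b. s \<in> T \<Longrightarrow> a \<in> verts G \<Longrightarrow> b \<in> verts G \<Longrightarrow>
      closed_adj G s a = 1 \<Longrightarrow> closed_adj G s b = 1 \<Longrightarrow> closed_adj G a b = 0 \<Longrightarrow> a \<in> T \<or> b \<in> T"
  shows "graph_matrix G m \<in> Qcone_tilde (verts G) 1"
proof -
  let ?X = "verts G"
  have fin: "finite ?X" using G by (simp add: simple_graph_def)
  have finT: "finite T" using finite_subset [OF T(1) fin] .
  define q where "q = 1 / real (card T)"
  have cT: "0 < real (card T)" using finT T(2) by (simp add: card_gt_0_iff)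
  then have q: "0 < q" "q * real (card T) = 1" by (auto simp: q_def)
  define p where "p = const q * (\<Sum>s\<in>T. var s)"
  have hom_cvar: "homogeneous 1 (const c * var s)" for c :: real and s :: 'a
    using homogeneous_mult [OF homogeneous_const homogeneous_var] by simp
  have nn: "nonneg_coeffs p"
    unfolding p_def using q by (intro nonneg_coeffs_mult nonneg_coeffs_const nonneg_coeffs_sum nonneg_coeffs_var) simp
  have polys: "p \<in> polys ?X"
    unfolding p_def using T(1) by (intro polys_mult polys_const polys_sum polys_var) auto
  have "homogeneous 1 p"
    unfolding p_def sum_distrib_left by (intro homogeneous_sum hom_cvar)
  then have Ncone: "p \<in> Ncone ?X 1"
    using nn polys by (simp add: Ncone_def nonneg_coeffs_def)
  have norm: "norm1 p = 1"
    unfolding norm1_eq_peval [OF nn] using q by (simp add: p_def peval_mult peval_sum)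
  \<comment> \<open>The matrix of the graph is \<open>P s + m * D s\<close>, where \<open>P s\<close> is positive semidefinite.\<close>
  define D where "D s a b = closed_adj G a b - (if f s a = f s b then 1 else 0)" for s a b
  define P where "P s a b = real m * (if f s a = f s b then 1 else 0) - 1" for s a b
  define E where "E s a b = (if s \<in> T then D s a b else 0)" for s a b
  have "psd ?X (P s)" if "s \<in> T" for s
    using psd_partition [OF fin, of "{..<m}" "f s"] range [OF that] unfolding P_def by auto
  then have 1: "(\<Sum>s\<in>T. const q * var s * quad_form ?X (P s)) \<in> Hcone ?X 1"
    using T(1) q
    by (intro Hcone_sum [OF fin] Hcone_mult_psd [OF fin] hom_cvar polys_mult polys_const polys_var
        nonneg_coeffs_mult nonneg_coeffs_const nonneg_coeffs_var) auto
  have E_sym: "E s a b = E s b a" for s a b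
    by (auto simp: E_def D_def closed_adj_commute [of G a b])
  have neg: "0 \<le> E s a b + E a s b + E b s a"
    if X: "s \<in> ?X" "a \<in> ?X" "b \<in> ?X" and neg: "E s a b < 0" for s a b
  proof -
    have s: "s \<in> T" using neg by (auto simp: E_def split: if_splits)
    have ab: "closed_adj G a b = 0" "f s a = f s b"
      using neg closed_adj_cases [OF G, of a b] by (auto simp: E_def D_def split: if_splits)
    have "f s a = 0" using clique [OF s X(2,3) ab(2)] ab(1) by auto
    then have adj: "closed_adj G s a = 1" "closed_adj G s b = 1"
      using nbhd [OF s X(2)] nbhd [OF s X(3)] ab(2) by simp_all
    \<comment> \<open>For a neighbour \<open>c\<close> of \<open>s\<close> in \<open>T\<close>, the vertex \<open>s\<close> is in the neighbourhood class of \<open>c\<close> and \<open>d\<close> is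
      not, although \<open>s\<close> and \<open>d\<close> are adjacent.\<close>
    have one: "E c s d = 1" if c: "c \<in> T" "c \<in> ?X" "d \<in> ?X" "closed_adj G s c = 1" "closed_adj G s d = 1" "closed_adj G c d = 0" for c d
    proof -
      have "f c s = 0" "f c d \<noteq> 0"
        using nbhd [OF c(1)] X(1) c closed_adj_commute [of G s c] by auto
      then show ?thesis using c by (simp add: E_def D_def)
    qed
    have "E a s b = (if a \<in> T then 1 else 0)" "E b s a = (if b \<in> T then 1 else 0)"
      using one [of a b] one [of b a] X adj ab(1) closed_adj_commute [of G a b] by (auto simp: E_def)
    moreover have "E s a b = - 1" using s ab by (simp add: E_def D_def)
    ultimately show ?thesis using cover [OF s X(2,3) adj ab(1)] by auto
  qed
  have "0 \<le> E s a b + E a s b + E b s a" if X: "s \<in> ?X" "a \<in> ?X" "b \<in> ?X" for s a b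
  proof -
    consider "E s a b < 0" | "E a s b < 0" | "E b s a < 0" | "0 \<le> E s a b" "0 \<le> E a s b" "0 \<le> E b s a"
      by linarith
    then show ?thesis
    proof cases
      case 1
      then show ?thesis using neg X by blast
    next
      case 2
      then show ?thesis using neg [of a s b] X E_sym [of b a s] by simp
    next
      case 3
      then show ?thesis using neg [of b s a] X E_sym [of s b a] E_sym [of a b s] by simp
    qed simp
  qed
  then have nnE: "nonneg_coeffs (\<Sum>s\<in>?X. var s * quad_form ?X (E s))"
    by (rule nonneg_coeffs_cubic)
  have "var s * quad_form ?X (E s) = (if s \<in> T then var s * quad_form ?X (D s) else 0)" for s
    by (auto simp: E_def quad_form_def)
  then have "(\<Sum>s\<in>?X. var s * quad_form ?X (E s)) = (\<Sum>s\<in>T. var s * quad_form ?X (D s))"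
    using T(1) fin by (simp add: sum.If_cases Int_absorb1)
  with nnE have nnD: "nonneg_coeffs (\<Sum>s\<in>T. var s * quad_form ?X (D s))" by simp
  have "homogeneous (1 + 2) (var s * quad_form ?X (D s))" for s
    by (intro homogeneous_mult homogeneous_var homogeneous_quad_form)
  then have "homogeneous (1 + 2) (\<Sum>s\<in>T. var s * quad_form ?X (D s))"
    by (intro homogeneous_sum)
  then have "homogeneous (1 + 2) (const (q * m) * (\<Sum>s\<in>T. var s * quad_form ?X (D s)))"
    using homogeneous_mult [OF homogeneous_const] by fastforce
  then have 2: "const (q * m) * (\<Sum>s\<in>T. var s * quad_form ?X (D s)) \<in> Hcone ?X 1"
    using nnD T(1) q
    by (intro Hcone_nonneg [OF fin] polys_mult polys_const polys_sum polys_var quad_form_polys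
        nonneg_coeffs_mult nonneg_coeffs_const) auto
  have "const q * var s * quad_form ?X (graph_matrix G m) =
      const q * var s * quad_form ?X (P s) + const (q * m) * (var s * quad_form ?X (D s))" for s
  proof -
    have "quad_form ?X (graph_matrix G m) = quad_form ?X (P s) + const m * quad_form ?X (D s)"
      unfolding quad_form_add [symmetric] quad_form_scale [symmetric]
      by (rule quad_form_cong) (simp add: P_def D_def graph_matrix_def closed_adj_def algebra_simps)
    then show ?thesis by (simp add: const_mult distrib_left mult_ac)
  qed
  then have "p * quad_form ?X (graph_matrix G m) =
      (\<Sum>s\<in>T. const q * var s * quad_form ?X (P s)) + const (q * m) * (\<Sum>s\<in>T. var s * quad_form ?X (D s))"
    unfolding p_def by (simp add: sum_distrib_left sum_distrib_right sum.distrib)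
  then have "p * quad_form ?X (graph_matrix G m) \<in> Hcone ?X 1"
    using Hcone_add [OF fin 1 2] by simp
  then show ?thesis
    using Ncone norm symmetric_graph_matrix by (auto simp: Qcone_tilde_def)
qed

lemma Qcone_tilde_lower_bound:
  assumes "simple_graph G" "graph_matrix G t \<in> Qcone_tilde (verts G) r" "stable G S" "S \<noteq> {}"
  shows "real (card S) \<le> t"
proof -
  obtain p where p: "p \<in> Ncone (verts G) r" "norm1 p = 1"
    "p * quad_form (verts G) (graph_matrix G t) \<in> Hcone (verts G) r"
    using assms(2) by (auto simp: Qcone_tilde_def)
  have "p \<noteq> 0" using p(2) by (auto simp: norm1_def)
  then show ?thesis
    using stable_lower_bound [OF assms(1) _ _ _ p(3) assms(3,4)] p(1)
    by (simp add: Ncone_def nonneg_coeffs_def)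
qed

lemma Qcone_tilde_0: "Qcone_tilde X 0 = Qcone X 0"
proof -
  have eq_1: "p = 1" if "p \<in> Ncone X 0" "norm1 p = 1" for p
  proof -
    have "degree_le 0 p" using that(1) degree_le_homogeneous by (auto simp: Ncone_def)
    then have p: "p = const (lookup p 0)" by (rule degree_le_0_const)
    have nn: "nonneg_coeffs p" using that(1) by (simp add: Ncone_def nonneg_coeffs_def)
    have "peval (\<lambda>_. 1) p = lookup p 0" by (subst p) (rule peval_const)
    then have "lookup p 0 = 1" using norm1_eq_peval [OF nn] that(2) by simp
    then show ?thesis using p by simp
  qed
  have "1 \<in> Ncone X 0" "norm1 1 = 1"
    using nonneg_coeffs_1 by (auto simp: Ncone_def nonneg_coeffs_def norm1_def)
  then have "(\<exists>p\<in>Ncone X 0. norm1 p = 1 \<and> p * f \<in> Hcone X 0) \<longleftrightarrow> f \<in> Hcone X 0" for f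
    using eq_1 by (metis mult_1)
  then show ?thesis by (simp add: Qcone_tilde_def Qcone_def)
qed

lemma nu_tilde_0: "nu_tilde 0 G = nu 0 G"
  by (simp add: nu_tilde_def nu_def Qcone_tilde_0)

text \<open>
  At order 1 the stability number itself is admissible, hence the least admissible value; at order 0
  the bound is \<open>nu 0 G\<close>, which is larger.
\<close>

lemma nu_tilde_rank_eq_1:
  assumes G: "simple_graph G" and ne: "verts G \<noteq> {}"
    and 1: "graph_matrix G (stability_number G) \<in> Qcone_tilde (verts G) 1"
    and 0: "graph_matrix G (stability_number G) \<notin> Qcone (verts G) 0"
  shows "nu_tilde_rank G = 1"
proof (rule antisym)
  obtain S where S: "stable G S" "card S = stability_number G"
    using stability_number_attained [OF G] .
  obtain a where "a \<in> verts G" using ne by blast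
  moreover have "{a, a} \<notin> edges G" using G by (auto simp: simple_graph_def)
  ultimately have "stable G {a}" by (simp add: stable_def)
  then have "S \<noteq> {}" using card_stable_le [OF G, of "{a}"] S by auto
  then have "nu_tilde 1 G = stability_number G"
    unfolding nu_tilde_def using 1 Qcone_tilde_lower_bound [OF G _ S(1)] S(2)
    by (intro Least_equality) auto
  then show "nu_tilde_rank G \<le> 1"
    unfolding nu_tilde_rank_def one_enat_def by (intro Inf_lower) auto
  have "nu_tilde 0 G \<noteq> stability_number G"
    using nu_gt_stability_number [OF G ne 0] by (simp add: nu_tilde_0)
  then have "1 \<le> enat r" if "nu_tilde r G = stability_number G" for r
    using that by (cases r) (auto simp: one_enat_def)
  then show "1 \<le> nu_tilde_rank G"
    unfolding nu_tilde_rank_def by (intro Inf_greatest) auto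
qed

section \<open>The graphs \<open>G\<^sub>k\<close>\<close>

lemma verts_Gk:
  "Vu i \<in> verts (Gk k) \<longleftrightarrow> i \<le> k" "Vv i \<in> verts (Gk k) \<longleftrightarrow> i \<le> k"
  "Vw i \<in> verts (Gk k) \<longleftrightarrow> 1 \<le> i \<and> i \<le> k"
  by (auto simp: Gk_def)

lemma edges_Gk:
  "{x} \<notin> edges (Gk k)" "{Vu i, Vu j} \<notin> edges (Gk k)" "{Vv i, Vv j} \<notin> edges (Gk k)" "{Vw i, Vw j} \<notin> edges (Gk k)"
  "{Vu i, Vv j} \<in> edges (Gk k) \<longleftrightarrow> i \<le> k \<and> j \<le> k \<and> (i = j \<longrightarrow> i = 0)"
  "{Vv j, Vu i} \<in> edges (Gk k) \<longleftrightarrow> i \<le> k \<and> j \<le> k \<and> (i = j \<longrightarrow> i = 0)"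
  "{Vu i, Vw j} \<in> edges (Gk k) \<longleftrightarrow> i = j \<and> 1 \<le> i \<and> i \<le> k"
  "{Vw j, Vu i} \<in> edges (Gk k) \<longleftrightarrow> i = j \<and> 1 \<le> i \<and> i \<le> k"
  "{Vv i, Vw j} \<in> edges (Gk k) \<longleftrightarrow> i = j \<and> 1 \<le> i \<and> i \<le> k"
  "{Vw j, Vv i} \<in> edges (Gk k) \<longleftrightarrow> i = j \<and> 1 \<le> i \<and> i \<le> k"
  by (auto simp: Gk_def doubleton_eq_iff)

text \<open>
  Outside the closed neighbourhood of \<open>u\<^sub>i\<close> the classes are the edges \<open>u\<^sub>j w\<^sub>j\<close> for \<open>j \<noteq> 0, i\<close> and, if
  \<open>i \<noteq> 0\<close>, the edge \<open>u\<^sub>0 v\<^sub>i\<close>, which takes the free number \<open>i\<close>. For \<open>v\<^sub>i\<close> the roles of \<open>u\<close> and \<open>v\<close> are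
  exchanged. The value at \<open>w\<^sub>i\<close> is a default.
\<close>

definition clique_class :: "vertex \<Rightarrow> vertex \<Rightarrow> nat" where
  "clique_class s a = (case s of
     Vu i \<Rightarrow> (case a of Vu j \<Rightarrow> if j = i then 0 else if j = 0 then i else j
                     | Vv j \<Rightarrow> if j = i then i else 0
                     | Vw j \<Rightarrow> if j = i then 0 else j)
   | Vv i \<Rightarrow> (case a of Vv j \<Rightarrow> if j = i then 0 else if j = 0 then i else j
                     | Vu j \<Rightarrow> if j = i then i else 0
                     | Vw j \<Rightarrow> if j = i then 0 else j)
   | Vw i \<Rightarrow> 0)"

lemma closed_adj_eq_1: "closed_adj G a b = 1 \<longleftrightarrow> (a = b \<longleftrightarrow> {a, b} \<notin> edges G)"
  by (auto simp: closed_adj_def adjacency_def)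

lemma closed_adj_eq_0: "closed_adj G a b = 0 \<longleftrightarrow> a \<noteq> b \<and> {a, b} \<notin> edges G"
  by (auto simp: closed_adj_def adjacency_def)

lemma Gk_Qcone_tilde: "graph_matrix (Gk k) (k + 1) \<in> Qcone_tilde (verts (Gk k)) 1"
proof -
  let ?T = "Vu ` {0..k} \<union> Vv ` {0..k}"
  have "graph_matrix (Gk k) (real (k + 1)) \<in> Qcone_tilde (verts (Gk k)) 1"
  proof (rule clique_partitions_Qcone_tilde [where T = ?T and f = clique_class])
    show "simple_graph (Gk k)" by (rule simple_graph_Gk)
    show "?T \<subseteq> verts (Gk k)" "?T \<noteq> {}" by (auto simp: Gk_def)
    show "clique_class s a < k + 1" if "s \<in> ?T" "a \<in> verts (Gk k)" for s a
      using that by (auto simp: clique_class_def verts_Gk split: vertex.splits)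
    show "clique_class s a = 0 \<longleftrightarrow> closed_adj (Gk k) s a = 1" if "s \<in> ?T" "a \<in> verts (Gk k)" for s a
      using that by (cases a) (auto simp: clique_class_def verts_Gk closed_adj_eq_1 edges_Gk split: if_splits)
    show "closed_adj (Gk k) a b = 1"
      if "s \<in> ?T" "a \<in> verts (Gk k)" "b \<in> verts (Gk k)" "clique_class s a = clique_class s b" "clique_class s a \<noteq> 0" for s a b
      using that
      by (cases s; cases a; cases b) (auto simp: clique_class_def verts_Gk closed_adj_eq_1 edges_Gk split: if_splits)
    show "a \<in> ?T \<or> b \<in> ?T"
      if "s \<in> ?T" "a \<in> verts (Gk k)" "b \<in> verts (Gk k)" "closed_adj (Gk k) s a = 1" "closed_adj (Gk k) s b = 1"
        "closed_adj (Gk k) a b = 0" for s a b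
      using that
      by (cases s; cases a; cases b) (auto simp: verts_Gk closed_adj_eq_1 closed_adj_eq_0 edges_Gk)
  qed
  then show ?thesis by (simp add: add.commute)
qed

definition other_ws :: "nat \<Rightarrow> nat \<Rightarrow> vertex set" where
  "other_ws k i = Vw ` ({1..k} - {i})"

lemma stable_pair_other_ws:
  assumes i: "i \<in> {1..k}" and ab: "a \<in> {Vu 0, Vv 0, Vu i, Vv i, Vw i}" "b \<in> {Vu 0, Vv 0, Vu i, Vv i, Vw i}"
    "a \<noteq> b" "{a, b} \<notin> edges (Gk k)"
  shows "stable (Gk k) (insert a (insert b (other_ws k i)))" "card (insert a (insert b (other_ws k i))) = k + 1"
proof -
  have "{x, y} \<notin> edges (Gk k)" if "x \<in> insert a (insert b (other_ws k i))" "y \<in> insert a (insert b (other_ws k i))" for x y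
    using that ab i by (auto simp: other_ws_def edges_Gk insert_commute)
  moreover have "insert a (insert b (other_ws k i)) \<subseteq> verts (Gk k)"
    using ab i by (auto simp: other_ws_def verts_Gk)
  ultimately show "stable (Gk k) (insert a (insert b (other_ws k i)))"
    unfolding stable_def by blast
  have "card (other_ws k i) = k - 1"
    using i by (simp add: other_ws_def card_image inj_on_def)
  moreover have "a \<notin> other_ws k i" "b \<notin> other_ws k i" "finite (other_ws k i)"
    using ab by (auto simp: other_ws_def)
  ultimately show "card (insert a (insert b (other_ws k i))) = k + 1"
    using ab(3) i by simp
qed

text \<open>
  The certificate with linear multiplier at \<open>k + 1\<close> bounds the size of all stable sets, so the upper
  bound needs no case distinction on stable sets.
\<close>

lemma stability_number_Gk:
  assumes "k \<ge> 1"
  shows "stability_number (Gk k) = k + 1"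
proof (rule antisym)
  obtain S where S: "stable (Gk k) S" "card S = stability_number (Gk k)"
    using stability_number_attained [OF simple_graph_Gk] .
  show "stability_number (Gk k) \<le> k + 1"
  proof (cases "S = {}")
    case False
    then have "real (card S) \<le> real k + 1"
      using Qcone_tilde_lower_bound [OF simple_graph_Gk Gk_Qcone_tilde S(1)] by simp
    then show ?thesis using S(2) by linarith
  qed (use S(2) in simp)
  show "k + 1 \<le> stability_number (Gk k)"
    using card_stable_le [OF simple_graph_Gk stable_pair_other_ws(1)]
      stable_pair_other_ws(2) [of 1 k "Vu 0" "Vu 1"] assms
    by (metis atLeastAtMost_iff edges_Gk(2) insertCI le_refl vertex.inject(1) zero_neq_one)
qed

lemma critical_pair_Gk:
  assumes i: "i \<in> {1..k}" and R: "R \<subseteq> other_ws k i"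
    and abc: "a \<in> {Vu 0, Vv 0, Vu i, Vv i, Vw i}" "b \<in> {Vu 0, Vv 0, Vu i, Vv i, Vw i}" "c \<in> {Vu 0, Vv 0, Vu i, Vv i, Vw i}"
    "a \<noteq> c" "b \<noteq> c" "{a, c} \<notin> edges (Gk k)" "{b, c} \<notin> edges (Gk k)"
  shows "(a, b) \<in> critical_pairs (Gk k) R"
proof -
  have k: "k \<ge> 1" using i by auto
  have "max_stable (Gk k) (insert a (insert c (other_ws k i)))" "max_stable (Gk k) (insert b (insert c (other_ws k i)))"
    using stable_pair_other_ws [OF i] abc stability_number_Gk [OF k] by (auto simp: max_stable_def)
  moreover have "a \<notin> insert c (other_ws k i)" "b \<notin> insert c (other_ws k i)" "R \<subseteq> insert c (other_ws k i)"
    using abc R by (auto simp: other_ws_def)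
  ultimately show ?thesis
    unfolding critical_pairs_def mem_Collect_eq case_prod_conv by (intro exI [of _ "insert c (other_ws k i)"] conjI)
qed

lemma sym_critical_pairs: "sym (critical_pairs G R)"
  unfolding sym_def critical_pairs_def by blast

text \<open>
  Adjacent vertices of the 5-cycle \<open>u\<^sub>0 v\<^sub>0 u\<^sub>i w\<^sub>i v\<^sub>i\<close> have a common nonneighbour \<open>c\<close> on the cycle, and both
  complete \<open>c\<close> and the remaining \<open>w\<^sub>j\<close> to a maximum stable set; so all five vertices are linked.
\<close>

lemma linked_Gk:
  assumes i: "i \<in> {1..k}" and R: "R \<subseteq> other_ws k i"
  shows "(Vw i, Vu 0) \<in> (critical_pairs (Gk k) R)\<^sup>*" "(Vu 0, Vu i) \<in> (critical_pairs (Gk k) R)\<^sup>*"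
proof -
  have "(Vw i, Vv i) \<in> critical_pairs (Gk k) R"
    by (rule critical_pair_Gk [OF i R, of _ _ "Vv 0"]) (use i in \<open>auto simp: edges_Gk\<close>)
  moreover have "(Vv i, Vu 0) \<in> critical_pairs (Gk k) R"
    by (rule critical_pair_Gk [OF i R, of _ _ "Vu i"]) (use i in \<open>auto simp: edges_Gk\<close>)
  ultimately show w: "(Vw i, Vu 0) \<in> (critical_pairs (Gk k) R)\<^sup>*" by simp
  have "(Vw i, Vu i) \<in> critical_pairs (Gk k) R"
    by (rule critical_pair_Gk [OF i R, of _ _ "Vu 0"]) (use i in \<open>auto simp: edges_Gk\<close>)
  then show "(Vu 0, Vu i) \<in> (critical_pairs (Gk k) R)\<^sup>*"
    using symD [OF sym_rtrancl [OF sym_critical_pairs] w] by simp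
qed

lemma Gk_not_in_Qcone:
  assumes "k \<ge> 2" "r \<le> k - 2"
  shows "graph_matrix (Gk k) (stability_number (Gk k)) \<notin> Qcone (verts (Gk k)) r"
proof (rule critical_pairs_obstruction [OF simple_graph_Gk, of _ "Vw ` {1..r + 2}"])
  have le: "r + 2 \<le> k" using assms by simp
  show "stable (Gk k) (Vw ` {1..r + 2})"
    using le by (auto simp: stable_def verts_Gk edges_Gk)
  show "card (Vw ` {1..r + 2}) = r + 2" by (simp add: card_image inj_on_def)
  fix x y assume "x \<in> Vw ` {1..r + 2}" "y \<in> Vw ` {1..r + 2}" "x \<noteq> y"
  then obtain i j where ij: "i \<in> {1..r + 2}" "j \<in> {1..r + 2}" "x = Vw i" "y = Vw j" by blast
  let ?R = "Vw ` {1..r + 2} - {x, y}"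
  have "?R \<subseteq> other_ws k i" "?R \<subseteq> other_ws k j" using ij le by (auto simp: other_ws_def)
  moreover have "i \<in> {1..k}" "j \<in> {1..k}" using ij le by auto
  ultimately have "(x, Vu 0) \<in> (critical_pairs (Gk k) ?R)\<^sup>*" "(y, Vu 0) \<in> (critical_pairs (Gk k) ?R)\<^sup>*"
    using linked_Gk(1) ij(3,4) by blast+
  then show "(x, y) \<in> (critical_pairs (Gk k) ?R)\<^sup>*"
    using symD [OF sym_rtrancl [OF sym_critical_pairs]] by (meson rtrancl_trans)
qed

lemma Gk_not_in_Qcone_0:
  assumes "k \<ge> 1"
  shows "graph_matrix (Gk k) (stability_number (Gk k)) \<notin> Qcone (verts (Gk k)) 0"
proof (rule critical_pairs_obstruction [OF simple_graph_Gk, of _ "{Vu 0, Vu 1}"])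
  show "stable (Gk k) {Vu 0, Vu 1}" using assms by (auto simp: stable_def verts_Gk edges_Gk)
  show "card {Vu 0, Vu 1} = 0 + 2" by simp
  fix x y assume xy: "x \<in> {Vu 0, Vu 1}" "y \<in> {Vu 0, Vu 1}" "x \<noteq> y"
  have "(Vu 0, Vu 1) \<in> (critical_pairs (Gk k) {})\<^sup>*" using linked_Gk(2) [of 1 k "{}"] assms by simp
  moreover from this have "(Vu 1, Vu 0) \<in> (critical_pairs (Gk k) {})\<^sup>*"
    by (rule symD [OF sym_rtrancl [OF sym_critical_pairs]])
  moreover have "{Vu 0, Vu 1} - {x, y} = {}" using xy by auto
  ultimately show "(x, y) \<in> (critical_pairs (Gk k) ({Vu 0, Vu 1} - {x, y}))\<^sup>*" using xy by auto
qed

theorem theorem6p2: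
  fixes k :: nat
  assumes "k \<ge> 1"
  shows "nu_rank (Gk k) \<ge> enat (k - 1)
    \<and> (k \<ge> 2 \<longrightarrow> nu (k - 2) (Gk k) > real (stability_number (Gk k)))
    \<and> nu_tilde_rank (Gk k) = 1"
proof (intro conjI impI)
  have ne: "verts (Gk k) \<noteq> {}" by (simp add: Gk_def)
  have gt: "real (stability_number (Gk k)) < nu r (Gk k)" if "k \<ge> 2" "r \<le> k - 2" for r
    using nu_gt_stability_number [OF simple_graph_Gk ne Gk_not_in_Qcone [OF that]] .
  show "enat (k - 1) \<le> nu_rank (Gk k)"
    unfolding nu_rank_def
  proof (rule Inf_greatest, clarify)
    fix r assume eq: "nu r (Gk k) = real (stability_number (Gk k))"
    show "enat (k - 1) \<le> enat r"
    proof (rule ccontr)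
      assume "\<not> enat (k - 1) \<le> enat r"
      then have "k \<ge> 2" "r \<le> k - 2" by auto
      from gt [OF this] show False using eq by simp
    qed
  qed
  show "nu (k - 2) (Gk k) > real (stability_number (Gk k))" if "k \<ge> 2"
    using gt [OF that] by simp
  have "graph_matrix (Gk k) (stability_number (Gk k)) \<in> Qcone_tilde (verts (Gk k)) 1"
    using Gk_Qcone_tilde [of k] stability_number_Gk [OF assms] by (simp add: add.commute)
  then show "nu_tilde_rank (Gk k) = 1"
    using nu_tilde_rank_eq_1 [OF simple_graph_Gk ne _ Gk_not_in_Qcone_0 [OF assms]] by simp
qed

end
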